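(* Let $G$ be a group with generating set $X$ and assume that the Cayley graph $\Gamma(G,X)$ is hyperbolic. Let $H_1$ and $H_2$ be subgroups of $G$, each hyperbolically embedded in $(G,X)$. Then: (i) there are finitely many $H_1$-conjugacy classes of subgroups of the form $H_1\cap H_2^g$ with $g\in G$; (ii) if $K_1,\dots,K_n$ are representatives of the $H_1$-conjugacy classes of subgroups of the form $H_1\cap H_2^g$, $g\in G$, then $H_1$ is hyperbolic relative to $K_1,\dots,K_n$; (iii) the family $\{K_1,\dots,K_n\}$ is hyperbolically embedded in $(G,X)$.
   Context: Write $H^g=gHg^{-1}$. The generating set $X$ may be infinite; $d_X$ is the word metric. When $\Gamma(G,X)$ is hyperbolic, a finite family $\{Q_i\}_{i=1}^n$ of subgroups of $G$ is hyperbolically embedded in $(G,X)$ if and only if the following hold (take this as the definition): (Q1) for every $\varepsilon>0$ there is $R$ such that for $g\in G$, if the $d_X$-diameter of $Q_i\cap N_\varepsilon(gQ_j)$ is at least $R$ then $i=j$ and $g\in Q_i$ (here $N_\varepsilon$ is the $\varepsilon$-neighborhood in $\Gamma(G,X)$); (Q2) each $Q_i$ is generated by a finite subset $Y_i$; (Q3) there are $\mu\ge1$, $c\ge0$ with $|h|_{Y_i}\le\mu|h|_X+c$ for all $i$ and all $h\in Q_i$. A single subgroup $H$ is hyperbolically embedded in $(G,X)$ if the one-element family $\{H\}$ is. Here $H_1$ and $H_2$ are assumed hyperbolically embedded individually, not as a joint family. The $K_1,\dots,K_n$ represent distinct $H_1$-conjugacy classes, one representative for each class. *)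

theory Defs
  imports Complex_Main "HOL-Algebra.Generated_Groups" "HOL-Library.Extended_Nat"
    "HOL-Library.Extended_Nonnegative_Real"
begin

section \<open>Graphs and hyperbolicity\<close>

text \<open>
  A graph is given by its symmetric adjacency relation; loops are allowed and affect neither
  distances nor geodesics. The distance is meaningful only within a connected component.
\<close>

definition graph_dist :: "'v rel \<Rightarrow> 'v \<Rightarrow> 'v \<Rightarrow> nat" where
  "graph_dist E a b = (LEAST n. (a, b) \<in> E ^^ n)"

definition geodesic :: "'v rel \<Rightarrow> 'v \<Rightarrow> 'v \<Rightarrow> (nat \<Rightarrow> 'v) \<Rightarrow> nat \<Rightarrow> bool" where
  "geodesic E a b p l \<longleftrightarrow>
     p 0 = a \<and> p l = b \<and> (\<forall>k<l. (p k, p (Suc k)) \<in> E) \<and> graph_dist E a b = l"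

text \<open>
  Slim triangles, for edge-path geodesics joining vertices. Passing to triangles with corners in
  the interior of edges of the geometric realisation only changes the constant. Only one side is
  mentioned because the corners may be permuted cyclically.
\<close>

definition hyperbolic_graph :: "'v rel \<Rightarrow> bool" where
  "hyperbolic_graph E \<longleftrightarrow>
     (\<exists>\<delta>::real. \<delta> \<ge> 0 \<and>
       (\<forall>a b c p q r l m n.
          geodesic E a b p l \<longrightarrow> geodesic E b c q m \<longrightarrow> geodesic E c a r n \<longrightarrow>
          (\<forall>k\<le>l. (\<exists>k'\<le>m. real (graph_dist E (p k) (q k')) \<le> \<delta>) \<or>
                 (\<exists>k'\<le>n. real (graph_dist E (p k) (r k')) \<le> \<delta>))))"

section \<open>Cayley graphs and word metrics\<close>

text \<open>Generating sets are not required to be symmetric, so both a generator and its inverse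
  give an edge.\<close>

definition cayley :: "('a, 'b) monoid_scheme \<Rightarrow> 'a set \<Rightarrow> 'a rel" where
  "cayley G X = {(a, b). a \<in> carrier G \<and> b \<in> carrier G \<and>
     (inv\<^bsub>G\<^esub> a \<otimes>\<^bsub>G\<^esub> b \<in> X \<or> inv\<^bsub>G\<^esub> b \<otimes>\<^bsub>G\<^esub> a \<in> X)}"

definition word_dist :: "('a, 'b) monoid_scheme \<Rightarrow> 'a set \<Rightarrow> 'a \<Rightarrow> 'a \<Rightarrow> nat" where
  "word_dist G X = graph_dist (cayley G X)"

definition word_length :: "('a, 'b) monoid_scheme \<Rightarrow> 'a set \<Rightarrow> 'a \<Rightarrow> nat" where
  "word_length G X g = word_dist G X \<one>\<^bsub>G\<^esub> g"

definition word_diam :: "('a, 'b) monoid_scheme \<Rightarrow> 'a set \<Rightarrow> 'a set \<Rightarrow> ennreal" where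
  "word_diam G X A = (SUP a\<in>A. SUP b\<in>A. ennreal (real (word_dist G X a b)))"

definition word_nbhd ::
    "('a, 'b) monoid_scheme \<Rightarrow> 'a set \<Rightarrow> real \<Rightarrow> 'a set \<Rightarrow> 'a set" where
  "word_nbhd G X \<epsilon> A = {x \<in> carrier G. \<exists>a\<in>A. real (word_dist G X x a) \<le> \<epsilon>}"

section \<open>Hyperbolically embedded families\<close>

text \<open>
  The family is \<open>Q 1, \<dots>, Q n\<close>. Geometric separation of the family, together with undistortedness
  for some finite generating sets \<open>Y i\<close>, is the definition of hyperbolic embeddedness only when
  the Cayley graph of \<open>G\<close> with respect to \<open>X\<close> is hyperbolic.
\<close>

definition hyp_embedded ::
    "('a, 'b) monoid_scheme \<Rightarrow> 'a set \<Rightarrow> nat \<Rightarrow> (nat \<Rightarrow> 'a set) \<Rightarrow> bool" where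
  "hyp_embedded G X n Q \<longleftrightarrow>
     (\<forall>i\<in>{1..n}. subgroup (Q i) G) \<and>
     (\<forall>\<epsilon>::real. \<epsilon> > 0 \<longrightarrow>
       (\<exists>R::real. \<forall>g\<in>carrier G. \<forall>i\<in>{1..n}. \<forall>j\<in>{1..n}.
          word_diam G X (Q i \<inter> word_nbhd G X \<epsilon> (g <#\<^bsub>G\<^esub> Q j)) \<ge> ennreal R \<longrightarrow>
          i = j \<and> g \<in> Q i)) \<and>
     (\<exists>Y. (\<forall>i\<in>{1..n}. finite (Y i) \<and> Y i \<subseteq> Q i \<and> generate G (Y i) = Q i) \<and>
       (\<exists>\<mu> c::real. \<mu> \<ge> 1 \<and> c \<ge> 0 \<and>
         (\<forall>i\<in>{1..n}. \<forall>h\<in>Q i.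
            real (word_length G (Y i) h) \<le> \<mu> * real (word_length G X h) + c)))"

section \<open>Relatively hyperbolic groups\<close>

text \<open>
  We use the definition of relative hyperbolicity due to Dahmani, Guirardel and Osin: for some
  finite relative generating set \<open>X\<close>, the Cayley graph with respect to \<open>X\<close> together with the
  disjoint union of the peripheral subgroups is hyperbolic, and every \<open>Q i\<close> is locally finite
  for the relative metric \<open>rel_dist G X n Q i\<close>. For \<open>a, b\<close> in \<open>Q i\<close>, this is the length of a
  shortest path from \<open>a\<close> to \<open>b\<close> containing no edge that joins two elements of \<open>Q i\<close> and is
  labelled by a letter from the copy of \<open>Q i\<close>; it is infinite if there is no such path.

  The labels matter only here: an edge between elements of \<open>Q i\<close> remains admissible if it is
  also labelled by a letter from \<open>X\<close> or from another \<open>Q j\<close>. For hyperbolicity, multiple edges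
  are irrelevant and the ordinary union suffices.
\<close>

definition rel_edges :: "('a, 'b) monoid_scheme \<Rightarrow> 'a set \<Rightarrow> nat \<Rightarrow> (nat \<Rightarrow> 'a set) \<Rightarrow>
    nat \<Rightarrow> 'a rel" where
  "rel_edges G X n Q i =
     cayley G X \<union> (\<Union>j\<in>{1..n}. {(a, b) \<in> cayley G (Q j). \<not> (j = i \<and> a \<in> Q i \<and> b \<in> Q i)})"

definition rel_dist :: "('a, 'b) monoid_scheme \<Rightarrow> 'a set \<Rightarrow> nat \<Rightarrow> (nat \<Rightarrow> 'a set) \<Rightarrow>
    nat \<Rightarrow> 'a \<Rightarrow> 'a \<Rightarrow> enat" where
  "rel_dist G X n Q i a b = (INF m\<in>{m. (a, b) \<in> rel_edges G X n Q i ^^ m}. enat m)"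

definition rel_hyperbolic ::
    "('a, 'b) monoid_scheme \<Rightarrow> nat \<Rightarrow> (nat \<Rightarrow> 'a set) \<Rightarrow> bool" where
  "rel_hyperbolic G n Q \<longleftrightarrow>
     (\<forall>i\<in>{1..n}. subgroup (Q i) G) \<and>
     (\<exists>X. finite X \<and> X \<subseteq> carrier G \<and>
       generate G (X \<union> (\<Union>i\<in>{1..n}. Q i)) = carrier G \<and>
       hyperbolic_graph (cayley G (X \<union> (\<Union>i\<in>{1..n}. Q i))) \<and>
       (\<forall>i\<in>{1..n}. \<forall>a\<in>Q i. \<forall>r. finite {b \<in> Q i. rel_dist G X n Q i a b \<le> enat r}))"

section \<open>Conjugacy classes of intersections\<close>

definition conj_set :: "('a, 'b) monoid_scheme \<Rightarrow> 'a \<Rightarrow> 'a set \<Rightarrow> 'a set" where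
  "conj_set G g H = (g <#\<^bsub>G\<^esub> H) #>\<^bsub>G\<^esub> (inv\<^bsub>G\<^esub> g)"

definition conj_class :: "('a, 'b) monoid_scheme \<Rightarrow> 'a set \<Rightarrow> 'a set \<Rightarrow> 'a set set" where
  "conj_class G H K = (\<lambda>h. conj_set G h K) ` H"

definition conj_intersections ::
    "('a, 'b) monoid_scheme \<Rightarrow> 'a set \<Rightarrow> 'a set \<Rightarrow> 'a set set" where
  "conj_intersections G H1 H2 = (\<lambda>g. H1 \<inter> conj_set G g H2) ` carrier G"

definition intersection_classes ::
    "('a, 'b) monoid_scheme \<Rightarrow> 'a set \<Rightarrow> 'a set \<Rightarrow> 'a set set set" where
  "intersection_classes G H1 H2 = conj_class G H1 ` conj_intersections G H1 H2"

definition class_representatives ::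
    "('a, 'b) monoid_scheme \<Rightarrow> 'a set \<Rightarrow> 'a set \<Rightarrow> nat \<Rightarrow> (nat \<Rightarrow> 'a set) \<Rightarrow> bool" where
  "class_representatives G H1 H2 n K \<longleftrightarrow>
     (\<forall>i\<in>{1..n}. K i \<in> conj_intersections G H1 H2) \<and>
     bij_betw (\<lambda>i. conj_class G H1 (K i)) {1..n} (intersection_classes G H1 H2)"

end

theory Submission
  imports Defs
begin

text \<open>
  By stability of quasigeodesics, undistorted subgroups are quasiconvex and meet every ball of \<open>G\<close>
  in a finite set, although \<open>X\<close> may be infinite. A geodesic joining two points of
  \<open>K = H1 \<inter> g H2 g\<^sup>-\<^sup>1\<close> runs close to \<open>H1\<close> and to the coset \<open>g H2\<close>. Translating
  a vertex of it to the identity by an element of \<open>H1\<close>, the coset becomes one that passes near the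
  identity and near another point of a fixed ball of \<open>H1\<close>; by separation of \<open>H2\<close> there are
  only finitely many such cosets. This makes \<open>K\<close> quasiconvex, and it leaves finitely many classes
  of infinite intersections. Finite intersections are conjugate into a fixed ball of \<open>H1\<close> by a
  quasi-centre argument. Separation of the representatives follows from that of \<open>H1\<close> and \<open>H2\<close>.

  For relative hyperbolicity, geodesics of \<open>\<Gamma>(G,X)\<close>, pushed into \<open>H1\<close>, satisfy
  Bowditch's guessing-geodesics criterion in the coned-off Cayley graph of \<open>H1\<close>. The relative
  metrics are locally finite because the sides of a thin polygon in \<open>\<Gamma>(G,X)\<close> cannot
  fellow-travel for long along different peripheral cosets.
\<close>

section \<open>Hyperbolic geometry of integer-valued metrics\<close>

text \<open>The generating set may be infinite, so balls of \<open>G\<close> may be infinite and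
  cosets cannot be counted through short representatives. They are counted inside \<open>H1\<close>
  instead, whose balls are finite: a coset of \<open>H2\<close> is attached to an element of
  \<open>H1\<close> that determines it.

  Generators of the intersections are never exhibited directly. Over a hyperbolic graph, finite
  generation together with undistortedness is equivalent to quasiconvexity together with finite
  balls, a condition that can be checked for an intersection; the equivalence is used in one
  direction for \<open>H1\<close> and \<open>H2\<close> and in the other for the representatives.

  Both stability of quasigeodesics and the guessing criterion rest on the same estimate: halving a
  polygon with at most \<open>2 ^ k\<close> sides k times costs k constants, so a worst distance t
  is at most of order log t, hence bounded. All distances are natural numbers, so worst and best
  points exist without approximation.\<close>

lemma square_le_power2: "4 \<le> k \<Longrightarrow> k * k \<le> (2::nat) ^ k"
proof (induction k rule: nat_induct_at_least)
  case (Suc n)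
  have "Suc n * Suc n = n * n + 2 * n + 1" by (simp add: algebra_simps)
  also have "\<dots> \<le> n * n + n * n"
    using mult_le_mono1[OF Suc.hyps, of n] Suc.hyps by linarith
  finally show ?case using Suc.IH by simp
qed simp

lemma power2_le_linear_bounded:
  fixes a b k :: nat
  assumes "2 ^ k \<le> a * k + b"
  shows "k \<le> a + b + 4"
proof (rule ccontr)
  assume "\<not> k \<le> a + b + 4"
  then have k: "a + b + 4 < k" by simp
  then have "(a + b + 1) * k \<le> k * k" by (intro mult_le_mono1) simp
  also have "\<dots> \<le> 2 ^ k" using k by (intro square_le_power2) simp
  finally have "(a + b + 1) * k \<le> a * k + b" using assms by simp
  moreover have "b \<le> b * k" using k by simp
  ultimately show False using k by (simp add: algebra_simps)
qed

lemma ex_power2_between: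
  fixes n :: nat
  shows "\<exists>k. n \<le> 2 ^ k \<and> (2::nat) ^ k \<le> 2 * n + 1"
proof (induction n)
  case 0
  show ?case by (intro exI[of _ 0]) simp
next
  case (Suc n)
  then obtain k where k: "n \<le> 2 ^ k" "(2::nat) ^ k \<le> 2 * n + 1" by blast
  show ?case
  proof (cases "Suc n \<le> 2 ^ k")
    case True
    with k show ?thesis by (intro exI[of _ k]) simp
  next
    case False
    with k have "n = 2 ^ k" by simp
    moreover have "(1::nat) \<le> 2 ^ k" by simp
    ultimately have "Suc n \<le> 2 ^ Suc k" "(2::nat) ^ Suc k \<le> 2 * Suc n + 1" by simp_all
    then show ?thesis by blast
  qed
qed

text \<open>A large number cannot be at most a logarithm of itself: choosing \<open>2 ^ k\<close>
  within a factor of about two of \<open>a * t + b\<close> bounds \<open>2 ^ k\<close> linearly in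
  \<open>k\<close>. Quantifying over all \<open>k\<close> replaces the logarithm and fits the
  polygons with up to \<open>2 ^ k\<close> sides to which the lemma is applied.\<close>

lemma bounded_by_logarithm:
  fixes a b p q :: nat
  shows "\<exists>B. \<forall>t. (\<forall>k. a * t + b \<le> 2 ^ k \<longrightarrow> t \<le> p * k + q) \<longrightarrow> t \<le> B"
proof (intro exI allI impI)
  fix t
  assume *: "\<forall>k. a * t + b \<le> 2 ^ k \<longrightarrow> t \<le> p * k + q"
  obtain k where k: "a * t + b \<le> 2 ^ k" "(2::nat) ^ k \<le> 2 * (a * t + b) + 1"
    using ex_power2_between by blast
  have t: "t \<le> p * k + q" using * k by blast
  have "a * t \<le> a * (p * k + q)" using t by (rule mult_le_mono2)
  then have "2 ^ k \<le> (2 * a * p) * k + (2 * a * q + 2 * b + 1)"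
    using k(2) by (simp add: algebra_simps)
  from power2_le_linear_bounded[OF this]
  have "p * k \<le> p * (2 * a * p + (2 * a * q + 2 * b + 1) + 4)" by (rule mult_le_mono2)
  with t show "t \<le> p * (2 * a * p + (2 * a * q + 2 * b + 1) + 4) + q" by linarith
qed

section \<open>Metric intervals, slim polygons and quasigeodesics\<close>

locale discrete_geodesic_space =
  fixes V :: "'v set" and d :: "'v \<Rightarrow> 'v \<Rightarrow> nat"
  assumes dist_eq_0: "x \<in> V \<Longrightarrow> y \<in> V \<Longrightarrow> d x y = 0 \<longleftrightarrow> x = y"
    and dist_sym: "x \<in> V \<Longrightarrow> y \<in> V \<Longrightarrow> d x y = d y x"
    and dist_triangle: "x \<in> V \<Longrightarrow> y \<in> V \<Longrightarrow> z \<in> V \<Longrightarrow> d x z \<le> d x y + d y z"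
    and ex_geodesic: "x \<in> V \<Longrightarrow> y \<in> V \<Longrightarrow>
      \<exists>p. p 0 = x \<and> p (d x y) = y \<and> (\<forall>i\<le>d x y. p i \<in> V) \<and>
        (\<forall>i j. i \<le> j \<longrightarrow> j \<le> d x y \<longrightarrow> d (p i) (p j) = j - i)"
begin

text \<open>The metric interval, that is, the union of all geodesics from \<open>x\<close> to
  \<open>y\<close>; with it no geodesic has to be chosen.\<close>

definition between :: "'v \<Rightarrow> 'v \<Rightarrow> 'v set" where
  "between x y = {v \<in> V. d x v + d v y = d x y}"

definition slim :: "nat \<Rightarrow> bool" where
  "slim \<delta> \<longleftrightarrow> (\<forall>x\<in>V. \<forall>y\<in>V. \<forall>z\<in>V. \<forall>v\<in>between x y.
     \<exists>w\<in>between x z \<union> between z y. d v w \<le> \<delta>)"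

definition quasiconvex :: "nat \<Rightarrow> 'v set \<Rightarrow> bool" where
  "quasiconvex \<sigma> S \<longleftrightarrow> S \<subseteq> V \<and> (\<forall>a\<in>S. \<forall>b\<in>S. \<forall>v\<in>between a b. \<exists>s\<in>S. d v s \<le> \<sigma>)"

abbreviation set_dist :: "'v \<Rightarrow> 'v set \<Rightarrow> nat" where
  "set_dist w S \<equiv> Inf (d w ` S)"

lemma dist_self [simp]: "x \<in> V \<Longrightarrow> d x x = 0"
  using dist_eq_0 by blast

lemma between_subset: "v \<in> between x y \<Longrightarrow> v \<in> V"
  by (simp add: between_def)

lemma between_ends: "x \<in> V \<Longrightarrow> y \<in> V \<Longrightarrow> x \<in> between x y" "x \<in> V \<Longrightarrow> y \<in> V \<Longrightarrow> y \<in> between x y"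
  by (simp_all add: between_def)

lemma between_commute:
  assumes "x \<in> V" "y \<in> V"
  shows "between x y = between y x"
  using assms dist_sym by (auto simp: between_def)

text \<open>The chain of triangle inequalities from \<open>x\<close> over \<open>v\<close> and
  \<open>q\<close> to \<open>y\<close> is tight, so every geodesic from \<open>x\<close> to
  \<open>q\<close> can be continued through \<open>q\<close> to \<open>y\<close>.\<close>

lemma between_sub:
  assumes "x \<in> V" "y \<in> V" "q \<in> between x y" "v \<in> between x q"
  shows "v \<in> between x y" "q \<in> between v y"
proof -
  have V: "q \<in> V" "v \<in> V" using assms between_subset by blast+
  have "d x v + d v q = d x q" "d x q + d q y = d x y"
    using assms by (auto simp: between_def)
  moreover have "d x y \<le> d x v + d v y" "d v y \<le> d v q + d q y"
    using V assms dist_triangle by blast+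
  ultimately show "v \<in> between x y" "q \<in> between v y"
    using V by (auto simp: between_def)
qed

lemma between_sub':
  assumes "x \<in> V" "y \<in> V" "q \<in> between x y" "v \<in> between q y"
  shows "v \<in> between x y" "q \<in> between x v"
proof -
  have V: "q \<in> V" "v \<in> V" using assms between_subset by blast+
  have "q \<in> between y x" "v \<in> between y q"
    using assms V by (simp_all add: between_commute)
  from between_sub[OF assms(2,1) this] show "v \<in> between x y" "q \<in> between x v"
    using V assms by (simp_all add: between_commute)
qed

lemma ex_between_at:
  assumes "x \<in> V" "y \<in> V" "k \<le> d x y"
  obtains v where "v \<in> between x y" "d x v = k" "d v y = d x y - k"
proof -
  obtain p where p: "p 0 = x" "p (d x y) = y" "\<forall>i\<le>d x y. p i \<in> V"
    "\<forall>i j. i \<le> j \<longrightarrow> j \<le> d x y \<longrightarrow> d (p i) (p j) = j - i"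
    using ex_geodesic[OF assms(1,2)] by blast
  have "d (p 0) (p k) = k - 0" "d (p k) (p (d x y)) = d x y - k"
    using p(4)[rule_format, of 0 k] p(4)[rule_format, of k "d x y"] assms(3) by simp_all
  with p(1,2) have k: "d x (p k) = k" "d (p k) y = d x y - k" by simp_all
  moreover have "p k \<in> between x y"
    using k p(3) assms(3) by (simp add: between_def)
  ultimately show ?thesis using that by blast
qed

lemma set_dist_attained:
  assumes "S \<noteq> {}"
  obtains s where "s \<in> S" "d w s = set_dist w S"
proof -
  have "set_dist w S \<in> d w ` S" using assms by (intro Inf_nat_def1) simp
  then show ?thesis using that by force
qed

lemma set_dist_le: "s \<in> S \<Longrightarrow> set_dist w S \<le> d w s"
  by (intro wellorder_Inf_le1) simp

lemma dist_triangle3: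
  assumes "x \<in> V" "y \<in> V" "z \<in> V" "w \<in> V"
  shows "d x w \<le> d x y + d y z + d z w"
  using dist_triangle[of x y w] dist_triangle[of y z w] assms by linarith

text \<open>The diagonal ending at corner \<open>2 ^ k\<close> splits the polygon into two with at
  most \<open>2 ^ k\<close> sides each, and crossing the triangle costs \<open>D\<close> once per
  doubling. The sides form an arbitrary family \<open>L\<close> because the lemma serves both for
  intervals and for the sets in \<open>guessing_geodesics\<close>.\<close>

lemma polygon:
  assumes thin: "\<And>x y z w. x \<in> V \<Longrightarrow> y \<in> V \<Longrightarrow> z \<in> V \<Longrightarrow> w \<in> L x y \<Longrightarrow>
      \<exists>w'\<in>L x z \<union> L z y. d w w' \<le> D"
    and sub: "\<And>x y. x \<in> V \<Longrightarrow> y \<in> V \<Longrightarrow> L x y \<subseteq> V"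
    and "\<forall>i\<le>n. x i \<in> V" "0 < n" "n \<le> 2 ^ k" "w \<in> L (x 0) (x n)"
  shows "\<exists>i<n. \<exists>w'\<in>L (x i) (x (Suc i)). d w w' \<le> k * D"
  using assms(3-)
proof (induction k arbitrary: x n w)
  case 0
  then have "n = 1" by simp
  with 0 sub have "w \<in> L (x 0) (x (Suc 0))" "w \<in> V"
    by (auto simp: subset_iff)
  with \<open>n = 1\<close> show ?case by force
next
  case (Suc k)
  show ?case
  proof (cases "n \<le> 2 ^ k")
    case True
    from Suc.IH[OF Suc.prems(1,2) True Suc.prems(4)]
    obtain i w' where "i < n" "w' \<in> L (x i) (x (Suc i))" "d w w' \<le> k * D" by blast
    then show ?thesis by (intro exI[of _ i]) (auto intro!: bexI[of _ w'])
  next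
    case False
    define m where "m = (2::nat) ^ k"
    have m: "0 < m" "m < n" "0 < n - m" "n - m \<le> 2 ^ k"
      using False Suc.prems(3) by (auto simp: m_def)
    obtain w' where w': "w' \<in> L (x 0) (x m) \<union> L (x m) (x n)" "d w w' \<le> D"
      using thin[of "x 0" "x n" "x m" w] Suc.prems m by auto
    have "\<exists>i<n. \<exists>w''\<in>L (x i) (x (Suc i)). d w' w'' \<le> k * D"
    proof (cases "w' \<in> L (x 0) (x m)")
      case True
      have "\<forall>i\<le>m. x i \<in> V" "m \<le> 2 ^ k" using Suc.prems(1) m(2) m_def by auto
      from Suc.IH[OF this(1) m(1) this(2) True] show ?thesis
        using m(2) order_less_trans by blast
    next
      case False
      then have "w' \<in> L (x (0 + m)) (x (n - m + m))" using w' m(2) by simp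
      from Suc.IH[of "n - m" "\<lambda>i. x (i + m)", OF _ m(3,4) this] Suc.prems(1)
      obtain i w'' where "i < n - m" "w'' \<in> L (x (i + m)) (x (Suc i + m))" "d w' w'' \<le> k * D"
        using m(2) by fastforce
      then show ?thesis by (intro exI[of _ "i + m"]) auto
    qed
    then obtain i w'' where i: "i < n" "w'' \<in> L (x i) (x (Suc i))" "d w' w'' \<le> k * D" by blast
    have x: "x 0 \<in> V" "x m \<in> V" "x n \<in> V" "x i \<in> V" "x (Suc i) \<in> V"
      using Suc.prems(1) m i(1) by auto
    have "w \<in> V" "w' \<in> V" "w'' \<in> V"
      using sub[OF x(1,3)] sub[OF x(1,2)] sub[OF x(2,3)] sub[OF x(4,5)] Suc.prems(4) w'(1) i(2)
      by blast+
    with w' i(3) have "d w w'' \<le> D + k * D"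
      using dist_triangle[of w w' w''] by linarith
    with i show ?thesis by auto
  qed
qed

lemma slimD:
  assumes "slim \<delta>" "x \<in> V" "y \<in> V" "z \<in> V" "v \<in> between x y"
  shows "\<exists>w\<in>between x z \<union> between z y. d v w \<le> \<delta>"
  using assms unfolding slim_def by blast

lemma geodesic_polygon:
  assumes "slim \<delta>" "\<forall>i\<le>n. x i \<in> V" "0 < n" "n \<le> 2 ^ k" "w \<in> between (x 0) (x n)"
  shows "\<exists>i<n. \<exists>w'\<in>between (x i) (x (Suc i)). d w w' \<le> k * \<delta>"
  by (rule polygon[OF slimD[OF assms(1)] _ assms(2-)]) (auto dest: between_subset)

lemma slim_quadrilateral:
  assumes "slim \<delta>" "a \<in> V" "b \<in> V" "a' \<in> V" "b' \<in> V" "p \<in> between a b"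
  shows "\<exists>q\<in>between a a' \<union> between a' b' \<union> between b' b. d p q \<le> 2 * \<delta>"
proof -
  obtain w where w: "w \<in> between a a' \<union> between a' b" "d p w \<le> \<delta>"
    using slimD[OF assms(1,2,3,4,6)] by blast
  show ?thesis
  proof (cases "w \<in> between a a'")
    case False
    then obtain q where q: "q \<in> between a' b' \<union> between b' b" "d w q \<le> \<delta>"
      using slimD[OF assms(1,4,3,5), of w] w by blast
    have "p \<in> V" "w \<in> V" "q \<in> V" using w q assms(6) between_subset by blast+
    then have "d p q \<le> 2 * \<delta>" using w q dist_triangle[of p w q] by linarith
    with q show ?thesis by blast
  qed (use w in force)
qed

text \<open>Some \<open>s\<close> in \<open>S\<close> is close to the midpoint of \<open>x\<close>
  and \<open>y\<close>. A member \<open>f\<close> of \<open>F\<close> at distance at least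
  \<open>r\<close> from \<open>s\<close> is nearly that far from the midpoint, whereas slimness of
  the triangle \<open>x\<close>, \<open>f\<close>, \<open>y\<close> puts the midpoint closer to
  \<open>f\<close> than \<open>r\<close> by about half of \<open>d x y\<close>. The final 1 comes
  from halving a natural number.\<close>

lemma quasi_center:
  assumes slim: "slim \<delta>" and qc: "quasiconvex \<sigma> S" and F: "F \<subseteq> V"
    and x: "x \<in> S" "\<forall>f\<in>F. d x f \<le> r" and y: "y \<in> S" "\<forall>f\<in>F. d y f \<le> r"
    and minimal: "\<forall>s\<in>S. \<exists>f\<in>F. r \<le> d s f"
  shows "d x y \<le> 4 * \<delta> + 2 * \<sigma> + 1"
proof -
  have S: "S \<subseteq> V" using qc by (simp add: quasiconvex_def)
  have xy: "x \<in> V" "y \<in> V" using x y S by auto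
  obtain m where m: "m \<in> between x y" "d x m = d x y div 2" "d m y = d x y - d x y div 2"
    using ex_between_at[of x y "d x y div 2"] xy by auto
  obtain s where s: "s \<in> S" "d m s \<le> \<sigma>"
    using qc m x y unfolding quasiconvex_def by blast
  obtain f where f: "f \<in> F" "r \<le> d s f" using minimal s by blast
  have V: "m \<in> V" "s \<in> V" "f \<in> V" using m s f F S between_subset by blast+
  obtain w where w: "w \<in> between x f \<union> between f y" "d m w \<le> \<delta>"
    using slimD[OF slim xy, of f m] V m by blast
  have wV: "w \<in> V" using w between_subset by blast
  have r: "r \<le> \<sigma> + d m f"
    using f s dist_triangle[of s m f] dist_sym[of s m] V by linarith
  show ?thesis
  proof (cases "w \<in> between x f")
    case True
    then have "d x w + d w f = d x f" by (simp add: between_def)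
    moreover have "d x f \<le> r" using x f by blast
    ultimately have "d x m \<le> 2 * \<delta> + \<sigma>"
      using r w dist_triangle[of m w f] dist_triangle[of x w m] dist_sym[of w m] V wV xy
      by linarith
    with m show ?thesis by linarith
  next
    case False
    then have "d f w + d w y = d f y" using w by (auto simp: between_def)
    moreover have "d y f \<le> r" using y f by blast
    ultimately have "d m y \<le> 2 * \<delta> + \<sigma>"
      using r w dist_triangle[of m w f] dist_triangle[of m w y] V wV xy
        dist_sym[of f w] dist_sym[of y f] by linarith
    with m show ?thesis by linarith
  qed
qed

text \<open>Compare a point \<open>p\<close> of a geodesic farthest from the path with the part of the path joining
  points near the two points at distance \<open>2 * t\<close> from \<open>p\<close>: that part has length linear in \<open>t\<close>,
  hence passes within \<open>O(log t)\<close> of \<open>p\<close>.\<close>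

lemma quasi_geodesic_stability:
  assumes slim: "slim \<delta>"
  shows "\<exists>B. \<forall>x N. (\<forall>i\<le>N. x i \<in> V) \<longrightarrow> (\<forall>i<N. d (x i) (x (Suc i)) \<le> M) \<longrightarrow>
    (\<forall>i j. i \<le> j \<longrightarrow> j \<le> N \<longrightarrow> j - i \<le> \<mu> * d (x i) (x j) + c) \<longrightarrow>
    (\<forall>p\<in>between (x 0) (x N). \<exists>i\<le>N. d p (x i) \<le> B)"
proof -
  \<comment> \<open>The factor 6 bounds the distance of the two path points chosen near
    \<open>y\<close> and \<open>z\<close> below, as \<open>t + (2 * t + 2 * t) + t\<close>. The
    summand \<open>2 * \<delta>\<close> is the cost of a quadrilateral and \<open>M\<close> that of
    one step of the path.\<close>
  obtain B where B: "\<And>t. (\<And>k. (\<mu> * 6) * t + (c + 1) \<le> 2 ^ k \<Longrightarrow> t \<le> \<delta> * k + (2 * \<delta> + M)) \<Longrightarrow> t \<le> B"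
    using bounded_by_logarithm[of "\<mu> * 6" "c + 1" \<delta> "2 * \<delta> + M"] by metis
  show ?thesis
  proof (intro exI[of _ B] allI impI)
    fix x :: "nat \<Rightarrow> 'v" and N
    assume xV: "\<forall>i\<le>N. x i \<in> V" and step: "\<forall>i<N. d (x i) (x (Suc i)) \<le> M"
      and qg: "\<forall>i j. i \<le> j \<longrightarrow> j \<le> N \<longrightarrow> j - i \<le> \<mu> * d (x i) (x j) + c"
    let ?P = "x ` {..N}" and ?I = "between (x 0) (x N)"
    have P: "?P \<noteq> {}" "x 0 \<in> ?P" "x N \<in> ?P" by auto
    have ends: "x 0 \<in> V" "x N \<in> V" using xV by auto
    let ?T = "(\<lambda>p. set_dist p ?P) ` ?I"
    have near_ordered: "\<exists>i\<le>N. d w (x i) \<le> k * \<delta> + M"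
      if ij: "i \<le> j" "j \<le> N" and k: "\<mu> * d (x i) (x j) + c + 1 \<le> 2 ^ k" and w: "w \<in> between (x i) (x j)"
      for i j k w
    proof (cases "i = j")
      case True
      then have "d (x i) w + d w (x i) = 0" using w xV ij by (simp add: between_def)
      then show ?thesis using ij ends by (intro exI[of _ i]) auto
    next
      case False
      have "j - i \<le> 2 ^ k" using qg ij k by (metis add_leD1 le_trans)
      from geodesic_polygon[OF slim, of "j - i" "\<lambda>l. x (i + l)" k w] this
      obtain l w' where l: "l < j - i" "w' \<in> between (x (i + l)) (x (Suc (i + l)))" "d w w' \<le> k * \<delta>"
        using xV ij w False by fastforce
      have "d (x (i + l)) w' + d w' (x (Suc (i + l))) \<le> M"
        using l step ij by (simp add: between_def)
      moreover have "x (i + l) \<in> V" using xV l ij by simp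
      ultimately have "d w (x (i + l)) \<le> k * \<delta> + M"
        using l dist_triangle[of w w' "x (i + l)"] dist_sym[of w' "x (i + l)"]
          between_subset[OF w] between_subset[OF l(2)] by linarith
      then show ?thesis using l ij ends by (intro exI[of _ "i + l"]) auto
    qed
    \<comment> \<open>The path points found near \<open>y\<close> and \<open>z\<close> may occur
      along the path in either order.\<close>
    have near: "\<exists>i\<le>N. d w (x i) \<le> k * \<delta> + M"
      if ij: "i \<le> N" "j \<le> N" and k: "\<mu> * d (x i) (x j) + c + 1 \<le> 2 ^ k" and w: "w \<in> between (x i) (x j)"
      for i j k w
    proof (cases "i \<le> j")
      case True
      then show ?thesis using near_ordered[OF True ij(2) k w] by blast
    next
      case False
      have "w \<in> between (x j) (x i)" "\<mu> * d (x j) (x i) + c + 1 \<le> 2 ^ k"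
        using w k between_commute[of "x i" "x j"] dist_sym[of "x i" "x j"] xV ij by auto
      with near_ordered[of j i k w] False ij show ?thesis by auto
    qed
    have bdd: "set_dist p ?P \<le> d (x 0) (x N)" if "p \<in> ?I" for p
    proof -
      have "d p (x 0) \<le> d (x 0) (x N)"
        using that dist_sym[of p "x 0"] ends by (auto simp: between_def)
      with set_dist_le[OF P(2), of p] show ?thesis by linarith
    qed
    have finT: "finite ?T" by (rule finite_subset[of _ "{..d (x 0) (x N)}"]) (use bdd in auto)
    have neT: "?T \<noteq> {}" using between_ends[OF ends] by blast
    define t where "t = Max ?T"
    have tmax: "set_dist p ?P \<le> t" if "p \<in> ?I" for p
      using that finT by (auto simp: t_def)
    obtain p where p: "p \<in> ?I" "set_dist p ?P = t"
      using Max_in[OF finT neT] unfolding t_def by force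
    have pV: "p \<in> V" using p between_subset by blast
    have t_le: "t \<le> d p (x i)" if "i \<le> N" for i
      using set_dist_le[of "x i" ?P p] p that by auto
    \<comment> \<open>If the geodesic ends before distance \<open>2 * t\<close>, its endpoint is
      taken instead. It lies on the path, so the side joining it to the path is a single
      point.\<close>
    obtain y where y: "y \<in> between p (x 0)" "d p y = min (2 * t) (d p (x 0))"
      using ex_between_at[of p "x 0" "min (2 * t) (d p (x 0))"] pV ends by auto
    obtain z where z: "z \<in> between p (x N)" "d p z = min (2 * t) (d p (x N))"
      using ex_between_at[of p "x N" "min (2 * t) (d p (x N))"] pV ends by auto
    have yzV: "y \<in> V" "z \<in> V" using y z between_subset by blast+
    have y': "y \<in> between (x 0) p" using y between_commute pV ends by blast
    have yI: "y \<in> ?I" and py: "p \<in> between y (x N)" using between_sub[OF ends p(1) y'] by auto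
    have zI: "z \<in> ?I" using between_sub'[OF ends p(1) z(1)] by auto
    have pyz: "p \<in> between y z" using between_sub'[OF yzV(1) ends(2) py z(1)] by auto
    have pick: "\<exists>i\<le>N. d q (x i) \<le> t \<and> (d p q = 2 * t \<or> q = x i)"
      if q: "q \<in> ?I" and "d p q = 2 * t \<or> (\<exists>i\<le>N. q = x i)" for q
      using that(2)
    proof
      assume "d p q = 2 * t"
      moreover obtain s where "s \<in> ?P" "d q s = set_dist q ?P"
        using set_dist_attained[OF P(1)] by metis
      ultimately show ?thesis using tmax[OF q] by auto
    next
      assume "\<exists>i\<le>N. q = x i"
      then show ?thesis using between_subset[OF q] dist_self by auto
    qed
    have "d p y = 2 * t \<or> y = x 0" "d p z = 2 * t \<or> z = x N"
      using y z dist_eq_0[of y "x 0"] dist_eq_0[of z "x N"] yzV ends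
      by (auto simp: between_def min_def split: if_splits)
    then obtain i j where i: "i \<le> N" "d y (x i) \<le> t" "d p y = 2 * t \<or> y = x i"
      and j: "j \<le> N" "d z (x j) \<le> t" "d p z = 2 * t \<or> z = x j"
      using pick[OF yI] pick[OF zI] by blast
    have ij: "x i \<in> V" "x j \<in> V" using xV i j by auto
    \<comment> \<open>A side joining \<open>y\<close> or \<open>z\<close> to the path has length at
      most \<open>t\<close> and starts at distance \<open>2 * t\<close> from \<open>p\<close>, or it
      is a point of the path; either way it stays at distance \<open>t\<close> from
      \<open>p\<close>. If \<open>p\<close> is within \<open>2 * \<delta>\<close> of such a side,
      \<open>t\<close> is bounded at once.\<close>
    have far: "t \<le> d p w" if "w \<in> between q (x l)" "q \<in> V" "l \<le> N" "d q (x l) \<le> t" "d p q = 2 * t \<or> q = x l"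
      for q l w
    proof -
      have w: "w \<in> V" "d q w + d w (x l) = d q (x l)" using that(1) by (auto simp: between_def)
      show ?thesis using that(5)
      proof
        assume "d p q = 2 * t"
        then show ?thesis
          using w that(4) dist_triangle[of p w q] dist_sym[of q w] pV that(2) by linarith
      next
        assume q: "q = x l"
        then have "w = q" using w that(2) dist_eq_0[of q w] by simp
        then show ?thesis using t_le[OF that(3)] q by simp
      qed
    qed
    have "t \<le> \<delta> * k + (2 * \<delta> + M)" if k: "\<mu> * 6 * t + (c + 1) \<le> 2 ^ k" for k
    proof -
      obtain w where w: "w \<in> between y (x i) \<union> between (x i) (x j) \<union> between (x j) z" "d p w \<le> 2 * \<delta>"
        using slim_quadrilateral[OF slim yzV ij pyz] by blast
      consider "w \<in> between y (x i)" | "w \<in> between z (x j)" | "w \<in> between (x i) (x j)"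
        using w between_commute[OF ij(2) yzV(2)] by blast
      then show ?thesis
      proof cases
        case 1
        from far[OF this yzV(1) i] w show ?thesis by linarith
      next
        case 2
        from far[OF this yzV(2) j] w show ?thesis by linarith
      next
        case 3
        have "d p y \<le> 2 * t" "d p z \<le> 2 * t" using y z by auto
        then have "d (x i) (x j) \<le> 6 * t"
          using i(2) j(2) dist_triangle3[of "x i" y z "x j"] dist_triangle[of y p z]
            dist_sym[of y p] dist_sym[of "x i" y] pV yzV ij by linarith
        then have "\<mu> * d (x i) (x j) \<le> \<mu> * (6 * t)" by (rule mult_le_mono2)
        moreover have "\<mu> * (6 * t) + (c + 1) \<le> 2 ^ k" using k by (simp only: mult.assoc)
        ultimately have "\<mu> * d (x i) (x j) + c + 1 \<le> 2 ^ k" by linarith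
        from near[OF i(1) j(1) this 3] obtain l where l: "l \<le> N" "d w (x l) \<le> k * \<delta> + M" by blast
        have "t \<le> d p (x l)" using t_le l by blast
        also have "\<dots> \<le> 2 * \<delta> + (k * \<delta> + M)"
          using w l dist_triangle[of p w "x l"] pV xV between_subset[OF 3] by fastforce
        finally show ?thesis by (simp add: algebra_simps)
      qed
    qed
    then have tB: "t \<le> B" by (rule B)
    show "\<forall>p\<in>?I. \<exists>i\<le>N. d p (x i) \<le> B"
    proof
      fix q assume q: "q \<in> ?I"
      obtain s where "s \<in> ?P" "d q s = set_dist q ?P"
        using set_dist_attained[OF P(1)] by metis
      then show "\<exists>i\<le>N. d q (x i) \<le> B" using tmax[OF q] tB by force
    qed
  qed
qed

text \<open>Bowditch's criterion: a family of coarsely connected sets \<open>L x y\<close> with thin triangles lies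
  uniformly close to the geodesics.\<close>

lemma guessing_geodesics:
  assumes sub: "\<And>x y. x \<in> V \<Longrightarrow> y \<in> V \<Longrightarrow> L x y \<subseteq> V"
    and thin: "\<And>x y z w. x \<in> V \<Longrightarrow> y \<in> V \<Longrightarrow> z \<in> V \<Longrightarrow> w \<in> L x y \<Longrightarrow>
      \<exists>w'\<in>L x z \<union> L z y. d w w' \<le> D"
    and short: "\<And>x y w. x \<in> V \<Longrightarrow> y \<in> V \<Longrightarrow> d x y \<le> 1 \<Longrightarrow> w \<in> L x y \<Longrightarrow> d w x \<le> D"
    and chain: "\<And>x y. x \<in> V \<Longrightarrow> y \<in> V \<Longrightarrow> \<exists>z N. z 0 = x \<and> z N = y \<and>
      (\<forall>i\<le>N. z i \<in> L x y) \<and> (\<forall>i<N. d (z i) (z (Suc i)) \<le> D)"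
  shows "\<exists>\<delta>. slim \<delta>"
proof -
  \<comment> \<open>Crude estimate: a geodesic cut into unit edges is a polygon for
    \<open>L\<close>, and \<open>short\<close> keeps the set over a single edge near its start. So
    \<open>L x y\<close> is within a logarithm of \<open>d x y\<close> from the geodesics.\<close>
  have near: "\<exists>q\<in>between x y. d w q \<le> D * k + D"
    if xy: "x \<in> V" "y \<in> V" and w: "w \<in> L x y" and k: "d x y \<le> 2 ^ k" for x y w k
  proof (cases "d x y = 0")
    case True
    then have "d w x \<le> D" using short[OF xy _ w] by simp
    then show ?thesis using between_ends[OF xy] by (intro bexI[of _ x]) auto
  next
    case False
    obtain p where p: "p 0 = x" "p (d x y) = y" "\<forall>i\<le>d x y. p i \<in> V"
      "\<forall>i j. i \<le> j \<longrightarrow> j \<le> d x y \<longrightarrow> d (p i) (p j) = j - i"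
      using ex_geodesic[OF xy] by blast
    obtain i w' where i: "i < d x y" "w' \<in> L (p i) (p (Suc i))" "d w w' \<le> k * D"
      using polygon[where w = w and L = L, OF thin sub p(3) _ k] False w p(1,2) by auto
    have pi: "p i \<in> V" "p (Suc i) \<in> V" using p(3) i(1) by auto
    have "d (p i) (p (Suc i)) = 1" using p(4)[rule_format, of i "Suc i"] i(1) by simp
    then have "d w' (p i) \<le> D" using short[OF pi _ i(2)] by simp
    moreover have "w \<in> V" "w' \<in> V" using sub[OF xy] sub[OF pi] w i(2) by auto
    ultimately have "d w (p i) \<le> D * k + D"
      using dist_triangle[of w w' "p i"] i(3) pi by (simp add: mult.commute)
    moreover have "p i \<in> between x y"
      using p(4)[rule_format, of 0 i] p(4)[rule_format, of i "d x y"] p(1,2) i(1) pi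
      by (simp add: between_def)
    ultimately show ?thesis by blast
  qed
  obtain B where B: "\<And>t. (\<And>k. 4 * t + (4 * D + 2) \<le> 2 ^ k \<Longrightarrow> t \<le> D * k + 3 * D) \<Longrightarrow> t \<le> B"
    using bounded_by_logarithm[of 4 "4 * D + 2" D "3 * D"] by metis
  have L_close: "\<exists>q\<in>between x0 y0. d w0 q \<le> B"
    if xy0: "x0 \<in> V" "y0 \<in> V" and w0: "w0 \<in> L x0 y0" for x0 y0 w0
  proof -
    \<comment> \<open>Only pairs at distance at most \<open>n\<close> compete for the worst defect:
      the crude estimate makes the maximum finite, and the outer pieces used below are again such
      pairs. The bound \<open>B\<close> does not depend on \<open>n\<close>.\<close>
    define n where "n = d x0 y0"
    define T where "T = {t. \<exists>x y w. x \<in> V \<and> y \<in> V \<and> d x y \<le> n \<and> w \<in> L x y \<and>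
      t = set_dist w (between x y)}"
    have "t \<le> D * n + D" if tT: "t \<in> T" for t
    proof -
      obtain x y w where *: "x \<in> V" "y \<in> V" "d x y \<le> n" "w \<in> L x y"
        "t = set_dist w (between x y)"
        using tT unfolding T_def by blast
      have "n \<le> 2 ^ n" by simp
      then obtain q where q: "q \<in> between x y" "d w q \<le> D * n + D"
        using near[OF *(1,2,4), of n] *(3) le_trans by blast
      show ?thesis unfolding *(5) using set_dist_le[OF q(1), of w] q(2) by linarith
    qed
    then have "T \<subseteq> {..D * n + D}" by blast
    then have finT: "finite T" by (rule finite_subset) simp
    have inT: "set_dist w0 (between x0 y0) \<in> T"
      unfolding T_def n_def using xy0 w0 by blast
    define t where "t = Max T"
    have t_max: "set_dist w (between x y) \<le> t" if "x \<in> V" "y \<in> V" "d x y \<le> n" "w \<in> L x y" for x y w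
      unfolding t_def using that finT by (intro Max_ge) (auto simp: T_def)
    have "t \<in> T" unfolding t_def using finT inT by (intro Max_in) auto
    then obtain x y w where xy: "x \<in> V" "y \<in> V" and n: "d x y \<le> n" and w: "w \<in> L x y"
      and t: "t = set_dist w (between x y)"
      unfolding T_def by auto
    have wV: "w \<in> V" using w sub xy by blast
    obtain q where q: "q \<in> between x y" "d w q = t"
      using set_dist_attained[of "between x y" w] between_ends[OF xy] t by auto
    have qV: "q \<in> V" using q between_subset by blast
    \<comment> \<open>One more than \<open>t + 2 * D + t\<close>. If \<open>w\<close> were within
      \<open>2 * D\<close> of an outer piece, maximality of \<open>t\<close> would lead from
      \<open>q\<close> over \<open>w\<close> to a point of the outer interval within
      \<open>t + 2 * D + t\<close>, although that interval is at distance at least \<open>s\<close>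
      from \<open>q\<close>.\<close>
    define s where "s = 2 * t + 2 * D + 1"
    have t_le: "t \<le> d w r" if "r \<in> between x y" for r
      using set_dist_le[OF that] t by simp
    have side: "\<exists>a'\<in>between q a. d q a' \<le> s \<and>
        (\<forall>w'\<in>L a a' \<union> L a' a. d w w' \<le> 2 * D \<longrightarrow> t \<le> 3 * D)"
      if a: "a \<in> V" "d q a \<le> n" "t \<le> d w a" for a
    \<comment> \<open>A side shorter than \<open>s\<close> is not cut; its outer piece is
      \<open>L a a\<close>, which stays within \<open>D\<close> of \<open>a\<close>.\<close>
    proof (cases "d q a < s")
      case True
      have "t \<le> 3 * D" if "w' \<in> L a a" "d w w' \<le> 2 * D" for w'
      proof -
        have w': "w' \<in> V" "d w' a \<le> D" using short[OF a(1) a(1) _ that(1)] that(1) sub a(1) by auto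
        show ?thesis using dist_triangle[OF wV w'(1) a(1)] w'(2) that(2) a(3) by linarith
      qed
      with True show ?thesis using between_ends[OF qV a(1)] by (intro bexI[of _ a]) auto
    next
      case False
      then obtain a' where a': "a' \<in> between q a" "d q a' = s"
        using ex_between_at[of q a s] qV a(1) by auto
      have a'V: "a' \<in> V" using a' between_subset by blast
      have n': "d a a' \<le> n" "d a' a \<le> n"
        using a' a(2) dist_sym[OF a(1) a'V] by (auto simp: between_def)
      have "\<not> d w w' \<le> 2 * D" if w': "w' \<in> L a a' \<union> L a' a" for w'
      proof
        assume close: "d w w' \<le> 2 * D"
        have w'V: "w' \<in> V" using w' sub a a'V by blast
        have "set_dist w' (between a' a) \<le> t"
          using w' t_max[OF a(1) a'V n'(1)] t_max[OF a'V a(1) n'(2)] between_commute[OF a(1) a'V] by auto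
        moreover have "between a' a \<noteq> {}" using between_ends[OF a'V a(1)] by blast
        then obtain q' where q': "q' \<in> between a' a" "d w' q' = set_dist w' (between a' a)"
          by (rule set_dist_attained)
        ultimately have d_q': "d w' q' \<le> t" by simp
        have q'V: "q' \<in> V" using q' between_subset by blast
        have "a' \<in> between q q'" using between_sub'[OF qV a(1) a'(1) q'(1)] by blast
        then have "s \<le> d q q'" using a'(2) by (simp add: between_def)
        moreover have "d q q' \<le> d q w + d w w' + d w' q'" using qV wV w'V q'V by (rule dist_triangle3)
        ultimately show False
          using q(2) d_q' close dist_sym[OF qV wV] unfolding s_def by linarith
      qed
      with a' show ?thesis by auto
    qed
    have "d q x \<le> n" "d q y \<le> n"
      using q(1) n dist_sym[OF xy(1) qV] by (auto simp: between_def)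
    then have sides: "d q x \<le> n" "d q y \<le> n" "t \<le> d w x" "t \<le> d w y"
      using t_le between_ends[OF xy] by blast+
    obtain x' where x': "x' \<in> between q x" "d q x' \<le> s"
        "\<And>w'. w' \<in> L x x' \<Longrightarrow> d w w' \<le> 2 * D \<Longrightarrow> t \<le> 3 * D"
      using side[OF xy(1) sides(1,3)] by blast
    obtain y' where y': "y' \<in> between q y" "d q y' \<le> s"
        "\<And>w'. w' \<in> L y' y \<Longrightarrow> d w w' \<le> 2 * D \<Longrightarrow> t \<le> 3 * D"
      using side[OF xy(2) sides(2,4)] by blast
    have V': "x' \<in> V" "y' \<in> V" using x' y' between_subset by blast+
    have x'q: "x' \<in> between x q" using x'(1) between_commute[OF xy(1) qV] by blast
    have x'I: "x' \<in> between x y" and qI: "q \<in> between x' y" using between_sub[OF xy q(1) x'q] by auto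
    have y'I: "y' \<in> between x' y" using between_sub'[OF V'(1) xy(2) qI y'(1)] by auto
    have I: "between x' y' \<subseteq> between x y"
      using between_sub(1)[OF V'(1) xy(2) y'I] between_sub'(1)[OF xy x'I] by blast
    \<comment> \<open>The point \<open>w\<close> is within \<open>2 * D\<close> of one of the three
      pieces determined by \<open>x'\<close> and \<open>y'\<close>. The outer pieces bound
      \<open>t\<close> directly; the middle one spans a distance of at most \<open>2 * s\<close>,
      where the crude estimate gives a logarithm of \<open>t\<close>.\<close>
    have "t \<le> D * k + 3 * D" if k: "4 * t + (4 * D + 2) \<le> 2 ^ k" for k
    proof -
      obtain w1 where w1: "w1 \<in> L x x' \<union> L x' y" "d w w1 \<le> D" using thin[OF xy V'(1) w] by blast
      show ?thesis
      proof (cases "w1 \<in> L x x'")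
        case True
        from x'(3)[OF this] w1 show ?thesis by simp
      next
        case False
        then obtain w2 where w2: "w2 \<in> L x' y' \<union> L y' y" "d w1 w2 \<le> D"
          using thin[OF V'(1) xy(2) V'(2)] w1 by blast
        have w12: "w1 \<in> V" "w2 \<in> V" using w1 w2 sub xy V' by blast+
        have ww2: "d w w2 \<le> 2 * D" using dist_triangle[OF wV w12] w1 w2 by linarith
        show ?thesis
        proof (cases "w2 \<in> L y' y")
          case True
          from y'(3)[OF this ww2] show ?thesis by simp
        next
          case False
          then have w2L: "w2 \<in> L x' y'" using w2 by blast
          have "d x' y' \<le> 2 * s"
            using dist_triangle[OF V'(1) qV V'(2)] dist_sym[OF V'(1) qV] x' y' by linarith
          moreover have "2 * s = 4 * t + (4 * D + 2)" unfolding s_def by simp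
          ultimately have "d x' y' \<le> 2 ^ k" using k by (metis le_trans)
          from near[OF V' w2L this] obtain r where r: "r \<in> between x' y'" "d w2 r \<le> D * k + D" by blast
          have "r \<in> V" using r between_subset by blast
          from dist_triangle[OF wV w12(2) this] r ww2 t_le[of r] I show ?thesis by auto
        qed
      qed
    qed
    then have "t \<le> B" by (rule B)
    moreover obtain q0 where "q0 \<in> between x0 y0" "d w0 q0 = set_dist w0 (between x0 y0)"
      using set_dist_attained between_ends[OF xy0] by blast
    ultimately show ?thesis
      using t_max[OF xy0 _ w0] n_def by force
  qed
  \<comment> \<open>Converse direction, by connectedness: the chain in \<open>L x y\<close> starts
    close to the half from \<open>x\<close> to \<open>p\<close> and ends close to the half from
    \<open>p\<close> to \<open>y\<close>, so two nearby chain points are close to different halves.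
    As \<open>p\<close> lies between their shadows \<open>q\<close> and \<open>q'\<close>, it is
    close to \<open>q\<close> and hence to the chain.\<close>
  have close_L: "\<exists>w\<in>L x y. d p w \<le> 4 * D + 3 * B"
    if xy: "x \<in> V" "y \<in> V" and p: "p \<in> between x y" for x y p
  proof -
    have pV: "p \<in> V" using p between_subset by blast
    obtain z N where z: "z 0 = x" "z N = y" "\<And>i. i \<le> N \<Longrightarrow> z i \<in> L x y"
      "\<And>i. i < N \<Longrightarrow> d (z i) (z (Suc i)) \<le> D"
      using chain[OF xy] by blast
    have zV: "z i \<in> V" if "i \<le> N" for i using z(3)[OF that] sub xy by blast
    define P where "P u v i \<longleftrightarrow> (\<exists>q\<in>between u v. d (z i) q \<le> D + B)" for u v i
    have P: "P x p i \<or> P p y i" if i: "i \<le> N" for i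
    proof -
      obtain w' where w': "w' \<in> L x p \<union> L p y" "d (z i) w' \<le> D"
        using thin[OF xy pV z(3)[OF i]] by blast
      have w'V: "w' \<in> V" using w' sub xy pV by blast
      have "\<exists>q\<in>between x p \<union> between p y. d w' q \<le> B"
        using w' L_close xy pV by blast
      then obtain q where q: "q \<in> between x p \<union> between p y" "d w' q \<le> B" by blast
      have "q \<in> V" using q between_subset by blast
      then have "d (z i) q \<le> D + B" using q(2) w'(2) dist_triangle[of "z i" w' q] zV[OF i] w'V by linarith
      then show ?thesis using q(1) unfolding P_def by blast
    qed
    have P0: "P x p 0" "P p y N"
      unfolding P_def using z(1,2) between_ends xy pV by (force, force)
    have "\<exists>i\<le>N. \<exists>j\<le>N. P x p i \<and> P p y j \<and> d (z i) (z j) \<le> D"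
    proof (cases "P x p N")
      case True
      then show ?thesis using P0(2) zV by (intro exI[of _ N]) auto
    next
      case False
      define i where "i = (LEAST i. \<not> P x p i)"
      have i: "\<not> P x p i" "i \<le> N" unfolding i_def using False by (metis LeastI, metis Least_le)
      then obtain j where j: "i = Suc j" using P0(1) by (cases i) auto
      then have "P x p j" using not_less_Least[of j "\<lambda>i. \<not> P x p i"] i_def by auto
      then show ?thesis using i j P[OF i(2)] z(4)[of j] by (intro exI[of _ j]) auto
    qed
    then obtain i j where ij: "i \<le> N" "j \<le> N" "P x p i" "P p y j" "d (z i) (z j) \<le> D" by blast
    obtain q where q: "q \<in> between x p" "d (z i) q \<le> D + B" using ij unfolding P_def by blast
    obtain q' where q': "q' \<in> between p y" "d (z j) q' \<le> D + B" using ij unfolding P_def by blast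
    have V: "q \<in> V" "q' \<in> V" "z i \<in> V" "z j \<in> V" using q q' between_subset zV ij by blast+
    have "p \<in> between q y" using between_sub[OF xy p q(1)] by blast
    then have "p \<in> between q q'" using between_sub'[OF V(1) xy(2) _ q'(1)] by blast
    then have "d q p \<le> d q q'" by (simp add: between_def)
    moreover have "d q q' \<le> d q (z i) + d (z i) (z j) + d (z j) q'"
      using V by (intro dist_triangle3)
    ultimately have "d q p \<le> 3 * D + 2 * B"
      using q(2) q'(2) ij(5) dist_sym[OF V(1,3)] by linarith
    then have "d p (z i) \<le> 4 * D + 3 * B"
      using q(2) dist_triangle[OF pV V(1,3)] dist_sym[OF V(1,3)] dist_sym[OF V(1) pV] by linarith
    then show ?thesis using z(3) ij by blast
  qed
  have "slim (4 * D + 3 * B + D + B)"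
    unfolding slim_def
  proof (intro ballI)
    fix x y z v assume xyz: "x \<in> V" "y \<in> V" "z \<in> V" and v: "v \<in> between x y"
    obtain w where w: "w \<in> L x y" "d v w \<le> 4 * D + 3 * B" using close_L[OF xyz(1,2) v] by blast
    obtain w' where w': "w' \<in> L x z \<union> L z y" "d w w' \<le> D" using thin[OF xyz w(1)] by blast
    obtain q where q: "q \<in> between x z \<union> between z y" "d w' q \<le> B"
      using w' L_close xyz by blast
    have "v \<in> V" "w \<in> V" "w' \<in> V" "q \<in> V"
      using v w w' q sub xyz between_subset by blast+
    from dist_triangle3[OF this] w w' q
    show "\<exists>w\<in>between x z \<union> between z y. d v w \<le> 4 * D + 3 * B + D + B"
      by (intro bexI[of _ q]) auto
  qed
  then show ?thesis by blast
qed

end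

section \<open>Chains inside quasiconvex sets\<close>

context discrete_geodesic_space
begin

text \<open>Shadows in \<open>S\<close> of consecutive vertices of a geodesic are at most
  \<open>\<sigma> + 1 + \<sigma>\<close> apart. This is the origin of the generating sets consisting
  of elements of length at most \<open>2 * \<sigma> + 1\<close>.\<close>

lemma quasiconvex_chain:
  assumes "quasiconvex \<sigma> S" "x \<in> S" "y \<in> S"
  obtains p s where "\<And>i. i \<le> d x y \<Longrightarrow> p i \<in> between x y" "\<And>i. i \<le> d x y \<Longrightarrow> d x (p i) = i"
    "\<And>i. i \<le> d x y \<Longrightarrow> s i \<in> S" "\<And>i. i \<le> d x y \<Longrightarrow> d (p i) (s i) \<le> \<sigma>"
    "s 0 = x" "s (d x y) = y" "\<And>i. i < d x y \<Longrightarrow> d (s i) (s (Suc i)) \<le> 2 * \<sigma> + 1"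
proof -
  have S: "S \<subseteq> V" using assms(1) by (simp add: quasiconvex_def)
  have xy: "x \<in> V" "y \<in> V" using assms S by auto
  obtain p where p: "p 0 = x" "p (d x y) = y" "\<forall>i\<le>d x y. p i \<in> V"
    "\<forall>i j. i \<le> j \<longrightarrow> j \<le> d x y \<longrightarrow> d (p i) (p j) = j - i"
    using ex_geodesic[OF xy] by blast
  have dp: "d x (p i) = i" "d (p i) y = d x y - i" if "i \<le> d x y" for i
    using p(4)[rule_format, of 0 i] p(4)[rule_format, of i "d x y"] p(1,2) that by simp_all
  have pb: "p i \<in> between x y" if "i \<le> d x y" for i
    using dp[OF that] p(3) that by (simp add: between_def)
  have "\<exists>u\<in>S. d (p i) u \<le> \<sigma>" if "i \<le> d x y" for i
    using assms pb[OF that] unfolding quasiconvex_def by blast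
  then obtain u where u: "\<And>i. i \<le> d x y \<Longrightarrow> u i \<in> S \<and> d (p i) (u i) \<le> \<sigma>" by metis
  \<comment> \<open>The ends keep their exact position, so that the chain joins \<open>x\<close> and
    \<open>y\<close> themselves.\<close>
  define s where "s i = (if i = 0 then x else if i = d x y then y else u i)" for i
  have ends: "s 0 = x" "s (d x y) = y" using dist_eq_0[OF xy] by (auto simp: s_def)
  have s: "s i \<in> S" "d (p i) (s i) \<le> \<sigma>" if "i \<le> d x y" for i
    using u[OF that] assms(2,3) p(1,2) xy by (auto simp: s_def)
  have "d (s i) (s (Suc i)) \<le> 2 * \<sigma> + 1" if i: "i < d x y" for i
  proof -
    have V: "s i \<in> V" "p i \<in> V" "p (Suc i) \<in> V" "s (Suc i) \<in> V" using i s(1) S p(3) by auto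
    have "d (p i) (p (Suc i)) = 1" using p(4)[rule_format, of i "Suc i"] i by simp
    then show ?thesis
      using dist_triangle3[OF V] s(2)[of i] s(2)[of "Suc i"] i dist_sym[OF V(1,2)] by simp
  qed
  with that[of p s] dp pb s ends show ?thesis by blast
qed

end

section \<open>Hyperbolic graphs\<close>

lemma graph_dist_le: "(a, b) \<in> E ^^ n \<Longrightarrow> graph_dist E a b \<le> n"
  unfolding graph_dist_def by (rule Least_le)

lemma graph_dist_self [simp]: "graph_dist E a a = 0"
  using graph_dist_le[of a a 0 E] by simp

lemma relpow_segment:
  assumes "\<forall>k<l. (p k, p (Suc k)) \<in> E" "i \<le> j" "j \<le> l"
  shows "(p i, p j) \<in> E ^^ (j - i)"
  unfolding relpow_fun_conv using assms by (intro exI[of _ "\<lambda>k. p (i + k)"]) auto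

locale connected_graph =
  fixes V :: "'v set" and E :: "'v rel"
  assumes edges_subset: "E \<subseteq> V \<times> V" and sym_edges: "sym E"
    and connected: "a \<in> V \<Longrightarrow> b \<in> V \<Longrightarrow> (a, b) \<in> E\<^sup>*"
begin

lemma relpow_graph_dist: "a \<in> V \<Longrightarrow> b \<in> V \<Longrightarrow> (a, b) \<in> E ^^ graph_dist E a b"
  unfolding graph_dist_def using connected[of a b] by (auto simp: rtrancl_power intro: LeastI)

lemma relpow_sym: "(a, b) \<in> E ^^ n \<Longrightarrow> (b, a) \<in> E ^^ n"
proof (induction n arbitrary: b)
  case (Suc n)
  then obtain c where "(a, c) \<in> E ^^ n" "(c, b) \<in> E" by auto
  then have "(c, a) \<in> E ^^ n" "(b, c) \<in> E" using Suc.IH sym_edges by (auto dest: symD)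
  then show ?case by (rule relpow_Suc_I2[rotated])
qed simp

lemma ex_geodesic_path:
  assumes "a \<in> V" "b \<in> V"
  obtains p where "geodesic E a b p (graph_dist E a b)"
  using relpow_graph_dist[OF assms] unfolding relpow_fun_conv geodesic_def by blast

lemma geodesic_vertex:
  assumes "a \<in> V" "geodesic E a b p l" "k \<le> l"
  shows "p k \<in> V"
proof (cases k)
  case (Suc j)
  then have "(p j, p k) \<in> E" using assms by (auto simp: geodesic_def)
  then show ?thesis using edges_subset by blast
qed (use assms in \<open>simp add: geodesic_def\<close>)

lemma graph_dist_triangle:
  assumes "a \<in> V" "b \<in> V" "c \<in> V"
  shows "graph_dist E a c \<le> graph_dist E a b + graph_dist E b c"
  using relpow_graph_dist[OF assms(1,2)] relpow_graph_dist[OF assms(2,3)]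
  by (intro graph_dist_le) (auto simp: relpow_add)

lemma geodesic_dist:
  assumes "a \<in> V" "geodesic E a b p l" "i \<le> j" "j \<le> l"
  shows "graph_dist E (p i) (p j) = j - i"
proof -
  have p: "p 0 = a" "p l = b" "\<forall>k<l. (p k, p (Suc k)) \<in> E" "graph_dist E a b = l"
    using assms(2) by (auto simp: geodesic_def)
  have V: "a \<in> V" "p i \<in> V" "p j \<in> V" "b \<in> V"
    using geodesic_vertex[OF assms(1,2)] assms p by auto
  have "graph_dist E a (p i) \<le> i"
    using relpow_segment[OF p(3), of 0 i] p assms by (auto intro: graph_dist_le)
  moreover have "graph_dist E (p i) (p j) \<le> j - i"
    using relpow_segment[OF p(3)] assms by (auto intro: graph_dist_le)
  moreover have "graph_dist E (p j) b \<le> l - j"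
    using relpow_segment[OF p(3), of j l] p assms by (auto intro: graph_dist_le)
  moreover have "l \<le> graph_dist E a (p i) + graph_dist E (p i) (p j) + graph_dist E (p j) b"
    using graph_dist_triangle[OF V(1,2,4)] graph_dist_triangle[OF V(2,3,4)] p(4) by linarith
  ultimately show ?thesis using assms(3,4) by linarith
qed

sublocale discrete_geodesic_space V "graph_dist E"
proof
  fix x y assume xy: "x \<in> V" "y \<in> V"
  show "graph_dist E x y = 0 \<longleftrightarrow> x = y"
    using relpow_graph_dist[OF xy] by auto
  have le: "graph_dist E x y \<le> graph_dist E y x" if "x \<in> V" "y \<in> V" for x y
    using relpow_graph_dist[OF that(2,1)] relpow_sym by (intro graph_dist_le) blast
  show "graph_dist E x y = graph_dist E y x"
    using le[OF xy] le[OF xy(2,1)] by simp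
  obtain p where p: "geodesic E x y p (graph_dist E x y)" using ex_geodesic_path[OF xy] .
  show "\<exists>p. p 0 = x \<and> p (graph_dist E x y) = y \<and> (\<forall>i\<le>graph_dist E x y. p i \<in> V) \<and>
      (\<forall>i j. i \<le> j \<longrightarrow> j \<le> graph_dist E x y \<longrightarrow> graph_dist E (p i) (p j) = j - i)"
    using p geodesic_dist[OF xy(1) p] geodesic_vertex[OF xy(1) p]
    by (intro exI[of _ p]) (auto simp: geodesic_def)
qed (rule graph_dist_triangle)

lemma geodesic_between:
  assumes "a \<in> V" "geodesic E a b p l" "k \<le> l"
  shows "p k \<in> between a b" "graph_dist E a (p k) = k" "graph_dist E (p k) b = l - k"
  using geodesic_dist[OF assms(1,2), of 0 k] geodesic_dist[OF assms(1,2), of k l]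
    geodesic_vertex[OF assms] assms(2,3) by (auto simp: between_def geodesic_def)

lemma ex_geodesic_through:
  assumes "a \<in> V" "b \<in> V" "v \<in> between a b"
  obtains p where "geodesic E a b p (graph_dist E a b)" "p (graph_dist E a v) = v"
proof -
  let ?k = "graph_dist E a v" and ?l = "graph_dist E a b"
  have v: "v \<in> V" "?k + graph_dist E v b = ?l" using assms(3) by (auto simp: between_def)
  obtain p where p: "geodesic E a v p ?k" using ex_geodesic_path assms v by metis
  obtain q where q: "geodesic E v b q (graph_dist E v b)" using ex_geodesic_path assms v by metis
  define r where "r i = (if i \<le> ?k then p i else q (i - ?k))" for i
  have "(r i, r (Suc i)) \<in> E" if "i < ?l" for i
  proof -
    consider "i < ?k" | "i = ?k" | "?k < i" by linarith
    then show ?thesis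
    proof cases
      case 2
      then show ?thesis using p q v that unfolding r_def geodesic_def by auto
    next
      case 3
      then have "i - ?k < graph_dist E v b" "Suc i - ?k = Suc (i - ?k)" using v that by auto
      then show ?thesis using q 3 unfolding r_def geodesic_def by auto
    qed (use p in \<open>auto simp: r_def geodesic_def\<close>)
  qed
  moreover have "r 0 = a" "r ?k = v" using p by (auto simp: r_def geodesic_def)
  moreover have "r ?l = b"
  proof (cases "graph_dist E v b = 0")
    case True
    then show ?thesis using p q v by (auto simp: r_def geodesic_def)
  next
    case False
    then have "\<not> ?l \<le> ?k" "?l - ?k = graph_dist E v b" using v by auto
    then show ?thesis using q unfolding r_def geodesic_def by metis
  qed
  ultimately show ?thesis using that unfolding geodesic_def by blast
qed

text \<open>Compare \<open>w\<close> with the vertex of the given geodesic at the same distance from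
  \<open>x\<close>. Slimness with that vertex as third corner yields \<open>u\<close> within
  \<delta> of \<open>w\<close> on a geodesic ending at the vertex; its distance to the vertex is a
  difference of distances from \<open>x\<close> or from \<open>y\<close>, hence at most \<delta> as
  well.\<close>

lemma slim_close_to_geodesic:
  assumes "slim \<delta>" "x \<in> V" "geodesic E x y p l" "w \<in> between x y"
  shows "\<exists>k\<le>l. graph_dist E w (p k) \<le> 2 * \<delta>"
proof -
  let ?d = "graph_dist E"
  let ?k = "?d x w"
  have y: "y \<in> V" using geodesic_vertex[OF assms(2,3), of l] assms(3) by (simp add: geodesic_def)
  have w: "w \<in> V" "?k + ?d w y = l" using assms(3,4) by (auto simp: between_def geodesic_def)
  have k: "?k \<le> l" using w by simp
  let ?v = "p ?k"
  note v = geodesic_vertex[OF assms(2,3) k] geodesic_between[OF assms(2,3) k]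
  obtain u where u: "u \<in> between x ?v \<union> between ?v y" "?d w u \<le> \<delta>"
    using slimD[OF assms(1,2) y v(1) assms(4)] by blast
  have uV: "u \<in> V" using u between_subset by blast
  have "?d u ?v \<le> \<delta>"
  proof (cases "u \<in> between x ?v")
    case True
    then have "?d x u + ?d u ?v = ?k" using v by (simp add: between_def)
    with u(2) show ?thesis
      using dist_triangle[OF assms(2) uV w(1)] dist_sym[OF uV w(1)] by linarith
  next
    case False
    then have "?d ?v u + ?d u y = l - ?k" using u v by (auto simp: between_def)
    with u(2) show ?thesis
      using dist_triangle[OF w(1) uV y] dist_sym[OF uV v(1)] w(2) by linarith
  qed
  then have "?d w ?v \<le> 2 * \<delta>" using u(2) dist_triangle[OF w(1) uV v(1)] by linarith
  then show ?thesis using k by blast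
qed

text \<open>The definition of \<open>hyperbolic_graph\<close> ranges over all elements of the type.
  A point outside \<open>V\<close> has no edges, so the geodesics there are constant.\<close>

lemma geodesic_ends:
  assumes "geodesic E a b p l"
  shows "a \<in> V \<longleftrightarrow> b \<in> V" "a \<notin> V \<Longrightarrow> l = 0"
proof -
  have "a \<in> V \<and> b \<in> V" if "l \<noteq> 0"
  proof -
    from that obtain j where "l = Suc j" by (cases l) auto
    then have "(a, p (Suc 0)) \<in> E" "(p j, b) \<in> E" using assms unfolding geodesic_def by auto
    then show ?thesis using edges_subset by blast
  qed
  moreover have "a = b" if "l = 0" using that assms by (auto simp: geodesic_def)
  ultimately show "a \<in> V \<longleftrightarrow> b \<in> V" "a \<notin> V \<Longrightarrow> l = 0" by auto
qed

text \<open>From left to right a geodesic is chosen through the given point and the constant is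
  rounded up. From right to left slimness only gives closeness to some geodesic side, and
  \<open>2 * \<delta>\<close> is paid for moving to the prescribed one.\<close>

lemma hyperbolic_graph_iff_slim: "hyperbolic_graph E \<longleftrightarrow> (\<exists>\<delta>. slim \<delta>)"
proof
  assume "hyperbolic_graph E"
  then obtain \<delta> :: real where \<delta>: "\<And>a b c p q r l m n k. geodesic E a b p l \<Longrightarrow> geodesic E b c q m \<Longrightarrow>
      geodesic E c a r n \<Longrightarrow> k \<le> l \<Longrightarrow> (\<exists>k'\<le>m. real (graph_dist E (p k) (q k')) \<le> \<delta>) \<or>
        (\<exists>k'\<le>n. real (graph_dist E (p k) (r k')) \<le> \<delta>)"
    unfolding hyperbolic_graph_def by metis
  have "slim (nat \<lceil>\<delta>\<rceil>)"
    unfolding slim_def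
  proof (intro ballI)
    fix x y z v assume xyz: "x \<in> V" "y \<in> V" "z \<in> V" and v: "v \<in> between x y"
    obtain p where p: "geodesic E x y p (graph_dist E x y)" "p (graph_dist E x v) = v"
      using ex_geodesic_through[OF xyz(1,2) v] .
    obtain q where q: "geodesic E y z q (graph_dist E y z)" using ex_geodesic_path[OF xyz(2,3)] .
    obtain r where r: "geodesic E z x r (graph_dist E z x)" using ex_geodesic_path[OF xyz(3,1)] .
    have "graph_dist E x v \<le> graph_dist E x y" using v by (simp add: between_def)
    from \<delta>[OF p(1) q r this] p(2) obtain w where
      w: "w \<in> between y z \<union> between z x" "real (graph_dist E v w) \<le> \<delta>"
      using geodesic_between(1)[OF xyz(2) q] geodesic_between(1)[OF xyz(3) r] by auto
    have "graph_dist E v w \<le> nat \<lceil>\<delta>\<rceil>" using w(2) by linarith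
    then show "\<exists>w\<in>between x z \<union> between z y. graph_dist E v w \<le> nat \<lceil>\<delta>\<rceil>"
      using w(1) between_commute xyz by blast
  qed
  then show "\<exists>\<delta>. slim \<delta>" ..
next
  assume "\<exists>\<delta>. slim \<delta>"
  then obtain \<delta> where \<delta>: "slim \<delta>" ..
  have "(\<exists>k'\<le>m. real (graph_dist E (p k) (q k')) \<le> real (3 * \<delta>)) \<or>
      (\<exists>k'\<le>n. real (graph_dist E (p k) (r k')) \<le> real (3 * \<delta>))"
    if geo: "geodesic E a b p l" "geodesic E b c q m" "geodesic E c a r n" and k: "k \<le> l"
    for a b c p q r l m n k
  proof (cases "a \<in> V")
    case False
    then have "l = 0" using geo geodesic_ends by blast
    then have "p k = q 0" using geo k by (auto simp: geodesic_def)
    then show ?thesis by (intro disjI1 exI[of _ 0]) simp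
  next
    case True
    then have V: "a \<in> V" "b \<in> V" "c \<in> V" using geo geodesic_ends by blast+
    have pk: "p k \<in> V" "p k \<in> between a b"
      using geodesic_vertex[OF True geo(1) k] geodesic_between[OF True geo(1) k] by auto
    obtain w where w: "w \<in> between a c \<union> between c b" "graph_dist E (p k) w \<le> \<delta>"
      using slimD[OF \<delta> V(1,2,3) pk(2)] by blast
    have wV: "w \<in> V" using w between_subset by blast
    have "(\<exists>k'\<le>m. graph_dist E w (q k') \<le> 2 * \<delta>) \<or> (\<exists>k'\<le>n. graph_dist E w (r k') \<le> 2 * \<delta>)"
      using w(1) slim_close_to_geodesic[OF \<delta> V(2) geo(2)] slim_close_to_geodesic[OF \<delta> V(3) geo(3)]
        between_commute V by blast
    moreover have "graph_dist E (p k) u \<le> 3 * \<delta>" if "u \<in> V" "graph_dist E w u \<le> 2 * \<delta>" for u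
      using dist_triangle[OF pk(1) wV that(1)] w(2) that(2) by linarith
    ultimately show ?thesis
      using geodesic_vertex[OF V(2) geo(2)] geodesic_vertex[OF V(3) geo(3)]
      by (metis of_nat_le_iff)
  qed
  then show "hyperbolic_graph E"
    unfolding hyperbolic_graph_def by (intro exI[of _ "real (3 * \<delta>)"]) auto
qed

end

section \<open>Quasiconvex subgroups of groups with a hyperbolic Cayley graph\<close>

context group
begin

lemma sym_cayley: "sym (cayley G X)"
  by (auto simp: sym_def cayley_def)

lemma cayley_subset: "cayley G X \<subseteq> carrier G \<times> carrier G"
  by (auto simp: cayley_def)

lemma inv_mult_cancel:
  "g \<in> carrier G \<Longrightarrow> b \<in> carrier G \<Longrightarrow> inv g \<otimes> (g \<otimes> b) = b"
  "g \<in> carrier G \<Longrightarrow> b \<in> carrier G \<Longrightarrow> g \<otimes> (inv g \<otimes> b) = b"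
  by (simp_all add: m_assoc[symmetric])

lemma inv_mult_translate:
  "g \<in> carrier G \<Longrightarrow> a \<in> carrier G \<Longrightarrow> b \<in> carrier G \<Longrightarrow> inv (g \<otimes> a) \<otimes> (g \<otimes> b) = inv a \<otimes> b"
  by (simp add: inv_mult_group m_assoc inv_mult_cancel)

lemma cayley_translate:
  "g \<in> carrier G \<Longrightarrow> (a, b) \<in> cayley G X \<Longrightarrow> (g \<otimes> a, g \<otimes> b) \<in> cayley G X"
  by (auto simp: cayley_def inv_mult_translate)

lemma relpow_cayley_translate:
  assumes "g \<in> carrier G"
  shows "(a, b) \<in> cayley G X ^^ n \<Longrightarrow> (g \<otimes> a, g \<otimes> b) \<in> cayley G X ^^ n"
proof (induction n arbitrary: b)
  case (Suc n)
  then show ?case using cayley_translate[OF assms] by (meson relpow_Suc_E relpow_Suc_I)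
qed simp

lemma cayley_subgroup_closed:
  assumes "subgroup H G" "Y \<subseteq> H" "a \<in> H" "(a, b) \<in> cayley G Y"
  shows "b \<in> H"
proof -
  have ab: "a \<in> carrier G" "b \<in> carrier G" "inv a \<otimes> b \<in> H \<or> inv b \<otimes> a \<in> H"
    using assms(2,4) by (auto simp: cayley_def)
  have "inv (inv b \<otimes> a) = inv a \<otimes> b" using ab by (simp add: inv_mult_group)
  then have "inv a \<otimes> b \<in> H" using ab assms(1) by (metis subgroup.m_inv_closed)
  then have "a \<otimes> (inv a \<otimes> b) \<in> H" using assms by (simp add: subgroup.m_closed)
  then show ?thesis using ab by (simp add: inv_mult_cancel)
qed

lemma relpow_cayley_subgroup_closed:
  assumes "subgroup H G" "Y \<subseteq> H" "a \<in> H"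
  shows "(a, b) \<in> cayley G Y ^^ n \<Longrightarrow> b \<in> H"
proof (induction n arbitrary: b)
  case (Suc n)
  then show ?case using cayley_subgroup_closed[OF assms(1,2)] by (meson relpow_Suc_E)
qed (use assms in simp)

lemma cayley_subgroup:
  assumes "subgroup H G"
  shows "cayley (G\<lparr>carrier := H\<rparr>) Y = cayley G Y \<inter> H \<times> H"
  using subgroup.subset[OF assms] m_inv_consistent[OF assms] by (auto simp: cayley_def)

lemma relpow_cayley_subgroup:
  assumes "subgroup H G" "Y \<subseteq> H" "a \<in> H"
  shows "(a, b) \<in> cayley (G\<lparr>carrier := H\<rparr>) Y ^^ n \<longleftrightarrow> (a, b) \<in> cayley G Y ^^ n"
proof (induction n arbitrary: b)
  case (Suc n)
  show ?case
  proof
    assume "(a, b) \<in> cayley (G\<lparr>carrier := H\<rparr>) Y ^^ Suc n"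
    then show "(a, b) \<in> cayley G Y ^^ Suc n"
      using Suc cayley_subgroup[OF assms(1)] by auto
  next
    assume "(a, b) \<in> cayley G Y ^^ Suc n"
    then obtain c where c: "(a, c) \<in> cayley G Y ^^ n" "(c, b) \<in> cayley G Y" by auto
    have "c \<in> H" using relpow_cayley_subgroup_closed[OF assms] c by blast
    moreover have "b \<in> H" using cayley_subgroup_closed[OF assms(1,2) \<open>c \<in> H\<close>] c by blast
    ultimately have "(c, b) \<in> cayley (G\<lparr>carrier := H\<rparr>) Y" using c cayley_subgroup[OF assms(1)] by auto
    with c Suc show "(a, b) \<in> cayley (G\<lparr>carrier := H\<rparr>) Y ^^ Suc n" by auto
  qed
qed simp

text \<open>A path from an element of \<open>H\<close> with labels in \<open>Y\<close> never leaves
  \<open>H\<close>. Hence the word lengths of \<open>hyp_embedded\<close>, measured in the generally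
  disconnected graph \<open>cayley G Y\<close>, are those of the Cayley graph of
  \<open>H\<close>.\<close>

lemma graph_dist_cayley_subgroup:
  assumes "subgroup H G" "Y \<subseteq> H" "a \<in> H"
  shows "graph_dist (cayley (G\<lparr>carrier := H\<rparr>) Y) a b = graph_dist (cayley G Y) a b"
  unfolding graph_dist_def relpow_cayley_subgroup[OF assms] ..

lemma cayley_generate:
  assumes "Y \<subseteq> carrier G" "h \<in> generate G Y" "a \<in> carrier G"
  shows "(a, a \<otimes> h) \<in> (cayley G Y)\<^sup>*"
  using assms(2,3)
proof (induction arbitrary: a)
  case one
  then show ?case by simp
next
  case (incl h)
  then have "(a, a \<otimes> h) \<in> cayley G Y" 
    using assms(1) by (auto simp: cayley_def inv_mult_cancel)
  then show ?case ..
next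
  case (inv h)
  then have h: "h \<in> carrier G" using assms(1) by auto
  with inv have "inv (a \<otimes> inv h) \<otimes> a = h" by (simp add: inv_mult_group m_assoc)
  with inv h have "(a, a \<otimes> inv h) \<in> cayley G Y" by (auto simp: cayley_def)
  then show ?case ..
next
  case (eng h1 h2)
  have h: "h1 \<in> carrier G" "h2 \<in> carrier G"
    using eng.hyps generate_in_carrier[OF assms(1)] by auto
  then have "(a, a \<otimes> h1) \<in> (cayley G Y)\<^sup>*" "(a \<otimes> h1, a \<otimes> h1 \<otimes> h2) \<in> (cayley G Y)\<^sup>*"
    using eng by simp_all
  then show ?case using h eng.prems by (simp add: m_assoc)
qed

lemma connected_graph_cayley:
  assumes "Y \<subseteq> carrier G" "generate G Y = carrier G"
  shows "connected_graph (carrier G) (cayley G Y)"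
proof
  fix a b assume ab: "a \<in> carrier G" "b \<in> carrier G"
  then have "inv a \<otimes> b \<in> generate G Y" using assms by simp
  from cayley_generate[OF assms(1) this ab(1)] ab show "(a, b) \<in> (cayley G Y)\<^sup>*"
    by (simp add: m_assoc[symmetric])
qed (use sym_cayley cayley_subset in auto)

lemma connected_graph_cayley_subgroup:
  assumes "subgroup H G" "Y \<subseteq> H" "generate G Y = H"
  shows "connected_graph H (cayley (G\<lparr>carrier := H\<rparr>) Y)"
  using group.connected_graph_cayley[OF subgroup_imp_group[OF assms(1)], of Y]
    generate_consistent[OF assms(2,1)] assms by simp

lemma finite_cayley_ball:
  assumes "finite Y" "Y \<subseteq> carrier G" "a \<in> carrier G"
  shows "finite {b. (a, b) \<in> cayley G Y ^^ n}"
proof (induction n)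
  case (Suc n)
  let ?B = "{b. (a, b) \<in> cayley G Y ^^ n}"
  have "{b. (a, b) \<in> cayley G Y ^^ Suc n} \<subseteq> (\<Union>c\<in>?B. (\<lambda>y. c \<otimes> y) ` Y \<union> (\<lambda>y. c \<otimes> inv y) ` Y)"
  proof
    fix b assume "b \<in> {b. (a, b) \<in> cayley G Y ^^ Suc n}"
    then obtain c where c: "c \<in> ?B" "(c, b) \<in> cayley G Y" by auto
    then have cb: "c \<in> carrier G" "b \<in> carrier G" "inv c \<otimes> b \<in> Y \<or> inv b \<otimes> c \<in> Y"
      by (auto simp: cayley_def)
    have "b = c \<otimes> (inv c \<otimes> b)" "b = c \<otimes> inv (inv b \<otimes> c)"
      using cb by (simp_all add: inv_mult_group m_assoc[symmetric])
    with c(1) cb(3) show "b \<in> (\<Union>c\<in>?B. (\<lambda>y. c \<otimes> y) ` Y \<union> (\<lambda>y. c \<otimes> inv y) ` Y)" by blast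
  qed
  moreover have "finite \<dots>" using Suc assms(1) by blast
  ultimately show ?case by (rule finite_subset)
qed simp

end

section \<open>Local finiteness, separation and undistortedness\<close>

locale cayley_graph = group G for G (structure) +
  fixes X
  assumes X_subset: "X \<subseteq> carrier G" and X_generate: "generate G X = carrier G"
begin

sublocale connected_graph "carrier G" "cayley G X"
  using connected_graph_cayley X_subset X_generate .

abbreviation d :: "'a \<Rightarrow> 'a \<Rightarrow> nat" where "d \<equiv> graph_dist (cayley G X)"

lemma dist_translate:
  assumes "g \<in> carrier G" "a \<in> carrier G" "b \<in> carrier G"
  shows "d (g \<otimes> a) (g \<otimes> b) = d a b"
proof -
  have le: "d (g \<otimes> a) (g \<otimes> b) \<le> d a b" if "g \<in> carrier G" "a \<in> carrier G" "b \<in> carrier G" for g a b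
    using relpow_cayley_translate[OF that(1) relpow_graph_dist[OF that(2,3)]] by (rule graph_dist_le)
  have "d (inv g \<otimes> (g \<otimes> a)) (inv g \<otimes> (g \<otimes> b)) \<le> d (g \<otimes> a) (g \<otimes> b)"
    using assms by (intro le) auto
  then show ?thesis using le[OF assms] assms by (simp add: m_assoc[symmetric])
qed

lemma dist_one_inv_mult: "a \<in> carrier G \<Longrightarrow> b \<in> carrier G \<Longrightarrow> d \<one> (inv a \<otimes> b) = d a b"
  using dist_translate[of a \<one> "inv a \<otimes> b"] by (simp add: m_assoc[symmetric])

lemma between_translate:
  assumes "g \<in> carrier G" "a \<in> carrier G" "b \<in> carrier G" "v \<in> between a b"
  shows "g \<otimes> v \<in> between (g \<otimes> a) (g \<otimes> b)"
  using assms dist_translate[OF assms(1)] by (simp add: between_def)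

definition locally_finite :: "'a set \<Rightarrow> bool" where
  "locally_finite H \<longleftrightarrow> (\<forall>r. finite {h \<in> H. d \<one> h \<le> r})"

text \<open>Geometric separation with the diameter unfolded into two points of \<open>Q i\<close> at
  distance at least \<open>R\<close> and their companions in the translate of \<open>Q j\<close>.
  Distances are integers, so integral constants lose nothing.\<close>

definition separated_at :: "nat \<Rightarrow> (nat \<Rightarrow> 'a set) \<Rightarrow> nat \<Rightarrow> nat \<Rightarrow> bool" where
  "separated_at n Q \<epsilon> R \<longleftrightarrow> (\<forall>g\<in>carrier G. \<forall>i\<in>{1..n}. \<forall>j\<in>{1..n}.
     \<forall>a\<in>Q i. \<forall>b\<in>Q i. \<forall>a'\<in>Q j. \<forall>b'\<in>Q j.
       d a (g \<otimes> a') \<le> \<epsilon> \<longrightarrow> d b (g \<otimes> b') \<le> \<epsilon> \<longrightarrow> R \<le> d a b \<longrightarrow> i = j \<and> g \<in> Q i)"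

definition separated :: "nat \<Rightarrow> (nat \<Rightarrow> 'a set) \<Rightarrow> bool" where
  "separated n Q \<longleftrightarrow> (\<forall>\<epsilon>. \<exists>R. separated_at n Q \<epsilon> R)"

lemma separated_atD:
  assumes "separated_at n Q \<epsilon> R" "g \<in> carrier G" "i \<in> {1..n}" "j \<in> {1..n}"
    and "a \<in> Q i" "b \<in> Q i" "a' \<in> Q j" "b' \<in> Q j"
    and "d a (g \<otimes> a') \<le> \<epsilon>" "d b (g \<otimes> b') \<le> \<epsilon>" "R \<le> d a b"
  shows "i = j \<and> g \<in> Q i"
  using assms(1)[unfolded separated_at_def, rule_format, OF assms(2-11)] .

lemma separated_at_singleD:
  assumes "separated_at 1 (\<lambda>_. H) \<epsilon> R" "g \<in> carrier G" "a \<in> H" "b \<in> H" "a' \<in> H" "b' \<in> H"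
    and "d a (g \<otimes> a') \<le> \<epsilon>" "d b (g \<otimes> b') \<le> \<epsilon>" "R \<le> d a b"
  shows "g \<in> H"
  using separated_atD[OF assms(1,2), of 1 1 a b a' b'] assms by simp

lemma locally_finite_ball:
  assumes "subgroup H G" "locally_finite H" "a \<in> H"
  shows "finite {h \<in> H. d a h \<le> r}"
proof -
  have H: "H \<subseteq> carrier G" using assms(1) by (rule subgroup.subset)
  have "{h \<in> H. d a h \<le> r} \<subseteq> (\<lambda>h. a \<otimes> h) ` {h \<in> H. d \<one> h \<le> r}"
  proof
    fix h assume h: "h \<in> {h \<in> H. d a h \<le> r}"
    then have ah: "a \<in> carrier G" "h \<in> carrier G" using H assms(3) by auto
    then have "h = a \<otimes> (inv a \<otimes> h)" by (simp add: m_assoc[symmetric])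
    moreover have "inv a \<otimes> h \<in> H" using h assms by (simp add: subgroup.m_closed subgroup.m_inv_closed)
    ultimately show "h \<in> (\<lambda>h. a \<otimes> h) ` {h \<in> H. d \<one> h \<le> r}"
      using h dist_one_inv_mult[OF ah] by (intro image_eqI[of _ _ "inv a \<otimes> h"]) auto
  qed
  then show ?thesis using assms(2) unfolding locally_finite_def by (auto intro: finite_subset)
qed

text \<open>The chain from \<open>\<one>\<close> to \<open>h\<close> has \<open>d \<one> h\<close>
  steps, each of which is a letter of \<open>Y\<close>. So the subgroup is undistorted with
  multiplicative constant 1 and additive constant 0; local finiteness makes \<open>Y\<close> finite
  in the applications.\<close>

lemma quasiconvex_finite_generation:
  assumes K: "subgroup K G" and qc: "quasiconvex \<sigma> K"
  defines "Y \<equiv> {k \<in> K. d \<one> k \<le> 2 * \<sigma> + 1}"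
  shows "generate G Y = K" and "h \<in> K \<Longrightarrow> graph_dist (cayley G Y) \<one> h \<le> d \<one> h"
proof -
  have KG: "K \<subseteq> carrier G" using K by (rule subgroup.subset)
  have YK: "Y \<subseteq> K" by (auto simp: Y_def)
  have path: "(\<one>, h) \<in> cayley G Y ^^ d \<one> h" if h: "h \<in> K" for h
  proof -
    obtain s where s: "\<And>i. i \<le> d \<one> h \<Longrightarrow> s i \<in> K" "s 0 = \<one>" "s (d \<one> h) = h"
      "\<And>i. i < d \<one> h \<Longrightarrow> d (s i) (s (Suc i)) \<le> 2 * \<sigma> + 1"
      using quasiconvex_chain[OF qc subgroup.one_closed[OF K] h] by metis
    have "(s i, s (Suc i)) \<in> cayley G Y" if i: "i < d \<one> h" for i
    proof -
      have sK: "s i \<in> K" "s (Suc i) \<in> K" using s(1) i by auto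
      then have "s i \<in> carrier G" "s (Suc i) \<in> carrier G" using KG by auto
      moreover have "inv (s i) \<otimes> s (Suc i) \<in> Y"
        using s(4)[OF i] sK K calculation dist_one_inv_mult
        by (simp add: Y_def subgroup.m_closed subgroup.m_inv_closed)
      ultimately show ?thesis by (simp add: cayley_def)
    qed
    then show ?thesis using s(2,3) unfolding relpow_fun_conv by blast
  qed
  then show "h \<in> K \<Longrightarrow> graph_dist (cayley G Y) \<one> h \<le> d \<one> h" by (intro graph_dist_le)
  have sub: "subgroup (generate G Y) G" using YK KG by (intro generate_is_subgroup) auto
  show "generate G Y = K"
  proof
    show "generate G Y \<subseteq> K" using generate_subgroup_incl[OF YK K] .
    show "K \<subseteq> generate G Y"
      using relpow_cayley_subgroup_closed[OF sub _ subgroup.one_closed[OF sub] path]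
      by (auto intro: generate.incl)
  qed
qed

lemma undistorted_dist_bound:
  assumes H: "subgroup H G" and Y: "Y \<subseteq> H" "generate G Y = H"
    and und: "\<And>h. h \<in> H \<Longrightarrow> graph_dist (cayley G Y) \<one> h \<le> \<mu> * d \<one> h + c"
    and ab: "a \<in> H" "b \<in> H"
  shows "(a, b) \<in> cayley G Y ^^ graph_dist (cayley G Y) a b"
    and "graph_dist (cayley G Y) a b \<le> \<mu> * d a b + c"
proof -
  interpret H: connected_graph H "cayley (G\<lparr>carrier := H\<rparr>) Y"
    using connected_graph_cayley_subgroup[OF H Y] .
  have abG: "a \<in> carrier G" "b \<in> carrier G" "inv a \<otimes> b \<in> H"
    using ab subgroup.subset[OF H] H by (auto simp: subgroup.m_closed subgroup.m_inv_closed)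
  show "(a, b) \<in> cayley G Y ^^ graph_dist (cayley G Y) a b"
    using H.relpow_graph_dist[OF ab]
      relpow_cayley_subgroup[OF H Y(1) ab(1)] graph_dist_cayley_subgroup[OF H Y(1) ab(1)] by simp
  have "(\<one>, inv a \<otimes> b) \<in> cayley G Y ^^ graph_dist (cayley G Y) \<one> (inv a \<otimes> b)"
    using H.relpow_graph_dist[OF _ abG(3), of \<one>] subgroup.one_closed[OF H]
      relpow_cayley_subgroup[OF H Y(1)] graph_dist_cayley_subgroup[OF H Y(1)] by simp
  from relpow_cayley_translate[OF abG(1) this]
  have "graph_dist (cayley G Y) a b \<le> graph_dist (cayley G Y) \<one> (inv a \<otimes> b)"
    using abG by (intro graph_dist_le) (simp add: m_assoc[symmetric])
  also have "\<dots> \<le> \<mu> * d \<one> (inv a \<otimes> b) + c" using und abG by blast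
  finally show "graph_dist (cayley G Y) a b \<le> \<mu> * d a b + c"
    using dist_one_inv_mult abG by simp
qed

text \<open>Undistortedness puts the part of a ball of \<open>G\<close> inside \<open>H\<close> into
  a word ball over the finite set \<open>Y\<close>, which is finite whatever the size of
  \<open>X\<close>.\<close>

lemma undistorted_locally_finite:
  assumes H: "subgroup H G" and Y: "finite Y" "Y \<subseteq> H" "generate G Y = H"
    and und: "\<And>h. h \<in> H \<Longrightarrow> graph_dist (cayley G Y) \<one> h \<le> \<mu> * d \<one> h + c"
  shows "locally_finite H"
  unfolding locally_finite_def
proof
  fix r
  have "{h \<in> H. d \<one> h \<le> r} \<subseteq> (\<Union>n\<le>\<mu> * r + c. {h. (\<one>, h) \<in> cayley G Y ^^ n})"
  proof
    fix h assume h: "h \<in> {h \<in> H. d \<one> h \<le> r}"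
    then have hH: "h \<in> H" and "\<mu> * d \<one> h \<le> \<mu> * r" by simp_all
    then have "graph_dist (cayley G Y) \<one> h \<le> \<mu> * r + c"
      using und[OF hH] by linarith
    then show "h \<in> (\<Union>n\<le>\<mu> * r + c. {h. (\<one>, h) \<in> cayley G Y ^^ n})"
      using undistorted_dist_bound(1)[OF H Y(2,3) und subgroup.one_closed[OF H] hH] by blast
  qed
  then show "finite {h \<in> H. d \<one> h \<le> r}"
    using finite_cayley_ball[OF Y(1)] Y(2) subgroup.subset[OF H] by (auto intro: finite_subset)
qed

text \<open>Word geodesics of \<open>H\<close> over \<open>Y\<close> are quasigeodesics of the
  ambient graph, with bounded steps because \<open>Y\<close> is finite, so geodesics of
  \<open>G\<close> with the same ends stay close to them.\<close>

lemma undistorted_quasiconvex: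
  assumes slim: "slim \<delta>" and H: "subgroup H G" and Y: "finite Y" "Y \<subseteq> H" "generate G Y = H"
    and und: "\<And>h. h \<in> H \<Longrightarrow> graph_dist (cayley G Y) \<one> h \<le> \<mu> * d \<one> h + c"
  shows "\<exists>\<sigma>. quasiconvex \<sigma> H"
proof -
  interpret H: connected_graph H "cayley (G\<lparr>carrier := H\<rparr>) Y"
    using connected_graph_cayley_subgroup[OF H Y(2,3)] .
  have HG: "H \<subseteq> carrier G" using H by (rule subgroup.subset)
  \<comment> \<open>The inserted 0 gives the maximum a value when \<open>Y\<close> is empty.\<close>
  define M where "M = Max (insert 0 (d \<one> ` Y))"
  have M: "d a b \<le> M" if "(a, b) \<in> cayley G Y" for a b
  proof -
    have ab: "a \<in> carrier G" "b \<in> carrier G" "inv a \<otimes> b \<in> Y \<or> inv b \<otimes> a \<in> Y"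
      using that by (auto simp: cayley_def)
    have "d \<one> y \<le> M" if "y \<in> Y" for y using that Y(1) by (simp add: M_def)
    then show ?thesis
      using ab dist_one_inv_mult[OF ab(1,2)] dist_one_inv_mult[OF ab(2,1)] dist_sym[OF ab(1,2)] by metis
  qed
  obtain B where B: "\<And>x N. (\<forall>i\<le>N. x i \<in> carrier G) \<Longrightarrow> (\<forall>i<N. d (x i) (x (Suc i)) \<le> M) \<Longrightarrow>
    (\<forall>i j. i \<le> j \<longrightarrow> j \<le> N \<longrightarrow> j - i \<le> \<mu> * d (x i) (x j) + c) \<Longrightarrow>
    (\<forall>p\<in>between (x 0) (x N). \<exists>i\<le>N. d p (x i) \<le> B)"
    using quasi_geodesic_stability[OF slim, of M \<mu> c] by metis
  have "\<exists>s\<in>H. d v s \<le> B" if ab: "a \<in> H" "b \<in> H" and v: "v \<in> between a b" for a b v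
  proof -
    obtain x where x: "geodesic (cayley (G\<lparr>carrier := H\<rparr>) Y) a b x (graph_dist (cayley (G\<lparr>carrier := H\<rparr>) Y) a b)"
      (is "geodesic _ _ _ _ ?N")
      using H.ex_geodesic_path[OF ab] .
    have xH: "x i \<in> H" if "i \<le> ?N" for i using H.geodesic_vertex[OF ab(1) x that] .
    have "\<forall>i\<le>?N. x i \<in> carrier G" using xH HG by blast
    moreover have "\<forall>i<?N. d (x i) (x (Suc i)) \<le> M"
      using x M unfolding geodesic_def cayley_subgroup[OF H] by blast
    moreover have "j - i \<le> \<mu> * d (x i) (x j) + c" if ij: "i \<le> j" "j \<le> ?N" for i j
    proof -
      have "x i \<in> H" "x j \<in> H" using xH ij by auto
      from undistorted_dist_bound(2)[OF H Y(2,3) und this] show ?thesis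
        using H.geodesic_dist[OF ab(1) x ij] graph_dist_cayley_subgroup[OF H Y(2) \<open>x i \<in> H\<close>] by simp
    qed
    ultimately have "\<forall>p\<in>between (x 0) (x ?N). \<exists>i\<le>?N. d p (x i) \<le> B" using B[of ?N x] by blast
    moreover have "x 0 = a" "x ?N = b" using x by (auto simp: geodesic_def)
    ultimately obtain i where "i \<le> ?N" "d v (x i) \<le> B" using v by auto
    then show ?thesis using xH by blast
  qed
  then show ?thesis using HG unfolding quasiconvex_def by blast
qed

lemma le_word_diam:
  assumes "a \<in> A" "b \<in> A"
  shows "ennreal (real (d a b)) \<le> word_diam G X A"
  unfolding word_diam_def word_dist_def using assms by (intro SUP_upper2[of a] SUP_upper2[of b]) auto

text \<open>Exchanges unknown generating sets for intrinsic conditions: from left to right by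
  stability of quasigeodesics, from right to left by taking short elements as generators. In this
  form embeddedness can be verified for intersections, for which no generators are given.\<close>

lemma hyp_embedded_iff:
  assumes slim: "slim \<delta>"
  shows "hyp_embedded G X n Q \<longleftrightarrow>
    (\<forall>i\<in>{1..n}. subgroup (Q i) G \<and> locally_finite (Q i) \<and> (\<exists>\<sigma>. quasiconvex \<sigma> (Q i))) \<and>
    separated n Q"
proof (intro iffI conjI ballI)
  assume emb: "hyp_embedded G X n Q"
  have sub: "\<And>i. i \<in> {1..n} \<Longrightarrow> subgroup (Q i) G" using emb by (simp add: hyp_embedded_def)
  show "separated n Q"
    unfolding separated_def
  proof
    fix \<epsilon> :: nat
    \<comment> \<open>Shifted by 1 because the definition speaks of positive radii and
      \<open>\<epsilon>\<close> may be 0.\<close>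
    have "real \<epsilon> + 1 > 0" by simp
    moreover have "\<forall>\<epsilon>::real. \<epsilon> > 0 \<longrightarrow> (\<exists>R::real. \<forall>g\<in>carrier G. \<forall>i\<in>{1..n}. \<forall>j\<in>{1..n}.
        ennreal R \<le> word_diam G X (Q i \<inter> word_nbhd G X \<epsilon> (g <# Q j)) \<longrightarrow> i = j \<and> g \<in> Q i)"
      using emb by (simp add: hyp_embedded_def)
    ultimately obtain R :: real where R: "\<And>g i j. g \<in> carrier G \<Longrightarrow> i \<in> {1..n} \<Longrightarrow> j \<in> {1..n} \<Longrightarrow>
        ennreal R \<le> word_diam G X (Q i \<inter> word_nbhd G X (real \<epsilon> + 1) (g <# Q j)) \<Longrightarrow>
          i = j \<and> g \<in> Q i"
      by blast
    have "i = j \<and> g \<in> Q i" if g: "g \<in> carrier G" and ij: "i \<in> {1..n}" "j \<in> {1..n}"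
      and ab: "a \<in> Q i" "b \<in> Q i" "a' \<in> Q j" "b' \<in> Q j"
      and close: "d a (g \<otimes> a') \<le> \<epsilon>" "d b (g \<otimes> b') \<le> \<epsilon>" and far: "nat \<lceil>R\<rceil> \<le> d a b"
      for g i j a b a' b'
    proof -
      let ?A = "Q i \<inter> word_nbhd G X (real \<epsilon> + 1) (g <# Q j)"
      have "a \<in> carrier G" "b \<in> carrier G"
        using ab subgroup.subset[OF sub[OF ij(1)]] by auto
      moreover have "g \<otimes> a' \<in> g <# Q j" "g \<otimes> b' \<in> g <# Q j" using ab by (auto simp: l_coset_def)
      moreover have "real (d a (g \<otimes> a')) \<le> real \<epsilon> + 1" "real (d b (g \<otimes> b')) \<le> real \<epsilon> + 1"
        using close by linarith+
      ultimately have "a \<in> ?A" "b \<in> ?A" using ab unfolding word_nbhd_def word_dist_def by blast+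
      then have "ennreal (real (d a b)) \<le> word_diam G X ?A" by (rule le_word_diam)
      moreover have "R \<le> real (d a b)" using far by linarith
      ultimately show ?thesis using R[OF g ij] ennreal_leI order_trans by blast
    qed
    then have "separated_at n Q \<epsilon> (nat \<lceil>R\<rceil>)" unfolding separated_at_def by blast
    then show "\<exists>R. separated_at n Q \<epsilon> R" ..
  qed
  fix i assume i: "i \<in> {1..n}"
  show H: "subgroup (Q i) G" using sub i .
  obtain Y \<mu> c where Y: "finite Y" "Y \<subseteq> Q i" "generate G Y = Q i"
    and und: "\<And>h. h \<in> Q i \<Longrightarrow> real (word_length G Y h) \<le> \<mu> * real (word_length G X h) + c"
    and \<mu>: "(1::real) \<le> \<mu>" "0 \<le> c"
    using emb i unfolding hyp_embedded_def by metis
  have und': "graph_dist (cayley G Y) \<one> h \<le> nat \<lceil>\<mu>\<rceil> * d \<one> h + nat \<lceil>c\<rceil>" if "h \<in> Q i" for h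
  proof -
    have "real (graph_dist (cayley G Y) \<one> h) \<le> \<mu> * real (d \<one> h) + c"
      using und[OF that] by (simp add: word_length_def word_dist_def)
    also have "\<dots> \<le> real (nat \<lceil>\<mu>\<rceil>) * real (d \<one> h) + real (nat \<lceil>c\<rceil>)"
      using \<mu> by (intro add_mono mult_right_mono) linarith+
    finally show ?thesis by (metis of_nat_add of_nat_le_iff of_nat_mult)
  qed
  show "locally_finite (Q i)" using undistorted_locally_finite[OF H Y und'] .
  show "\<exists>\<sigma>. quasiconvex \<sigma> (Q i)" using undistorted_quasiconvex[OF slim H Y und'] .
next
  assume *: "(\<forall>i\<in>{1..n}. subgroup (Q i) G \<and> locally_finite (Q i) \<and> (\<exists>\<sigma>. quasiconvex \<sigma> (Q i))) \<and>
    separated n Q"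
  then obtain \<sigma> where \<sigma>: "\<And>i. i \<in> {1..n} \<Longrightarrow> quasiconvex (\<sigma> i) (Q i)" by metis
  have sub: "\<And>i. i \<in> {1..n} \<Longrightarrow> subgroup (Q i) G" and lf: "\<And>i. i \<in> {1..n} \<Longrightarrow> locally_finite (Q i)"
    and sep: "separated n Q" using * by auto
  define Y where "Y i = {k \<in> Q i. d \<one> k \<le> 2 * \<sigma> i + 1}" for i
  have Y: "finite (Y i) \<and> Y i \<subseteq> Q i \<and> generate G (Y i) = Q i" if "i \<in> {1..n}" for i
    using quasiconvex_finite_generation(1)[OF sub \<sigma>, OF that that] lf[OF that]
    by (auto simp: Y_def locally_finite_def)
  have und: "real (word_length G (Y i) h) \<le> 1 * real (word_length G X h) + 0" if "i \<in> {1..n}" "h \<in> Q i" for i h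
    using quasiconvex_finite_generation(2)[OF sub \<sigma>, OF that(1,1,2)]
    by (simp add: Y_def word_length_def word_dist_def)
  have "\<exists>R::real. \<forall>g\<in>carrier G. \<forall>i\<in>{1..n}. \<forall>j\<in>{1..n}.
      ennreal R \<le> word_diam G X (Q i \<inter> word_nbhd G X \<epsilon> (g <# Q j)) \<longrightarrow> i = j \<and> g \<in> Q i" for \<epsilon> :: real
  proof -
    obtain R where R: "separated_at n Q (nat \<lfloor>\<epsilon>\<rfloor>) R" using sep unfolding separated_def by blast
    have "i = j \<and> g \<in> Q i" if g: "g \<in> carrier G" and ij: "i \<in> {1..n}" "j \<in> {1..n}"
      and diam: "ennreal (real R + 1) \<le> word_diam G X (Q i \<inter> word_nbhd G X \<epsilon> (g <# Q j))" for g i j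
    proof -
      \<comment> \<open>The summand 1 makes the lower bound on the supremum strict, so that some
        pair of points exceeds \<open>R\<close>.\<close>
      have "ennreal (real R) < ennreal (real R + 1)" by (intro ennreal_lessI) auto
      also note diam
      finally obtain a b where ab: "a \<in> Q i" "a \<in> word_nbhd G X \<epsilon> (g <# Q j)"
        "b \<in> Q i" "b \<in> word_nbhd G X \<epsilon> (g <# Q j)" "ennreal (real R) < ennreal (real (d a b))"
        unfolding word_diam_def word_dist_def less_SUP_iff by blast
      have "R \<le> d a b" using ab(5) by (simp add: ennreal_less_iff)
      moreover obtain a' b' where "a' \<in> Q j" "b' \<in> Q j" "real (d a (g \<otimes> a')) \<le> \<epsilon>" "real (d b (g \<otimes> b')) \<le> \<epsilon>"
        using ab(2,4) unfolding word_nbhd_def word_dist_def l_coset_def by blast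
      ultimately show ?thesis using separated_atD[OF R g ij ab(1,3)] le_nat_floor by blast
    qed
    then show ?thesis by blast
  qed
  then show "hyp_embedded G X n Q"
    unfolding hyp_embedded_def using sub Y und by (intro conjI exI[of _ Y] exI[of _ 1] exI[of _ 0]) auto
qed

end

section \<open>Intersections of conjugates\<close>

context group
begin

lemma bex_l_coset: "(\<exists>c\<in>g <# H. P c) \<longleftrightarrow> (\<exists>h\<in>H. P (g \<otimes> h))"
  unfolding l_coset_def by auto

lemma mem_l_coset:
  "g \<in> carrier G \<Longrightarrow> H \<subseteq> carrier G \<Longrightarrow> x \<in> g <# H \<longleftrightarrow> x \<in> carrier G \<and> inv g \<otimes> x \<in> H"
  unfolding l_coset_def by (auto simp: inv_mult_cancel subset_iff intro!: bexI[of _ "inv g \<otimes> x"])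

lemma mem_conj_set:
  assumes "g \<in> carrier G" "H \<subseteq> carrier G"
  shows "x \<in> conj_set G g H \<longleftrightarrow> x \<in> carrier G \<and> inv g \<otimes> x \<otimes> g \<in> H"
proof
  assume "x \<in> conj_set G g H"
  then obtain h where h: "h \<in> H" "x = g \<otimes> h \<otimes> inv g"
    unfolding conj_set_def l_coset_def r_coset_def by blast
  then have "h \<in> carrier G" using assms by auto
  with h assms show "x \<in> carrier G \<and> inv g \<otimes> x \<otimes> g \<in> H"
    by (simp add: m_assoc inv_mult_cancel)
next
  assume x: "x \<in> carrier G \<and> inv g \<otimes> x \<otimes> g \<in> H"
  have "x = g \<otimes> (inv g \<otimes> x \<otimes> g) \<otimes> inv g"
    using x assms by (simp add: m_assoc inv_mult_cancel)
  with x show "x \<in> conj_set G g H"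
    unfolding conj_set_def l_coset_def r_coset_def by blast
qed

lemma conj_set_subset: "g \<in> carrier G \<Longrightarrow> H \<subseteq> carrier G \<Longrightarrow> conj_set G g H \<subseteq> carrier G"
  using mem_conj_set by blast

lemma conj_set_conj_set:
  assumes "a \<in> carrier G" "b \<in> carrier G" "H \<subseteq> carrier G"
  shows "conj_set G a (conj_set G b H) = conj_set G (a \<otimes> b) H"
  using assms conj_set_subset[OF assms(2,3)]
  by (auto simp: mem_conj_set inv_mult_group m_assoc)

lemma conj_set_Int:
  assumes "a \<in> carrier G" "A \<subseteq> carrier G" "B \<subseteq> carrier G"
  shows "conj_set G a (A \<inter> B) = conj_set G a A \<inter> conj_set G a B"
  using assms by (auto simp: mem_conj_set le_infI1)

lemma conj_set_self:
  assumes "subgroup H G" "h \<in> H"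
  shows "conj_set G h H = H"
proof -
  have H: "H \<subseteq> carrier G" "h \<in> carrier G" "inv h \<in> H"
    using assms subgroup.subset[OF assms(1)] by (auto simp: subgroup.m_inv_closed)
  show ?thesis
  proof (intro equalityI subsetI)
    fix x assume "x \<in> conj_set G h H"
    then have x: "x \<in> carrier G" "inv h \<otimes> x \<otimes> h \<in> H" using mem_conj_set H by auto
    then have "h \<otimes> (inv h \<otimes> x \<otimes> h) \<otimes> inv h \<in> H" using assms H by (simp add: subgroup.m_closed)
    then show "x \<in> H" using x H by (simp add: m_assoc inv_mult_cancel)
  next
    fix x assume "x \<in> H"
    then show "x \<in> conj_set G h H"
      using mem_conj_set[OF H(2,1)] assms H by (auto simp: subgroup.m_closed)
  qed
qed

lemma subgroup_conj_set:
  assumes "subgroup H G" "g \<in> carrier G"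
  shows "subgroup (conj_set G g H) G"
proof -
  have H: "H \<subseteq> carrier G" using assms(1) by (rule subgroup.subset)
  note mem = mem_conj_set[OF assms(2) H]
  show ?thesis
  proof
    show "conj_set G g H \<subseteq> carrier G" using conj_set_subset[OF assms(2) H] .
    show "\<one> \<in> conj_set G g H" using assms by (simp add: mem subgroup.one_closed)
  next
    fix x y assume xy: "x \<in> conj_set G g H" "y \<in> conj_set G g H"
    then have "(inv g \<otimes> x \<otimes> g) \<otimes> (inv g \<otimes> y \<otimes> g) \<in> H"
      using assms(1) by (auto simp: mem subgroup.m_closed)
    then show "x \<otimes> y \<in> conj_set G g H"
      using xy assms(2) by (simp add: mem m_assoc inv_mult_cancel)
  next
    fix x assume x: "x \<in> conj_set G g H"
    then have "inv (inv g \<otimes> x \<otimes> g) \<in> H"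
      using assms(1) by (auto simp: mem subgroup.m_inv_closed)
    then show "inv x \<in> conj_set G g H"
      using x assms(2) by (simp add: mem inv_mult_group m_assoc)
  qed
qed

lemma conj_class_conj_set:
  assumes "subgroup H G" "u \<in> H" "K \<subseteq> carrier G"
  shows "conj_class G H (conj_set G u K) = conj_class G H K"
proof -
  have HG: "H \<subseteq> carrier G" using assms(1) by (rule subgroup.subset)
  have "conj_set G h (conj_set G u K) \<in> conj_class G H K" if "h \<in> H" for h
  proof -
    have "conj_set G h (conj_set G u K) = conj_set G (h \<otimes> u) K"
      using that assms HG by (intro conj_set_conj_set) auto
    then show ?thesis using that assms by (auto simp: conj_class_def subgroup.m_closed)
  qed
  moreover have "conj_set G h K \<in> conj_class G H (conj_set G u K)" if "h \<in> H" for h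
  proof -
    have V: "h \<in> carrier G" "u \<in> carrier G" using that assms HG by auto
    have "conj_set G h K = conj_set G (h \<otimes> inv u) (conj_set G u K)"
      using conj_set_conj_set[of "h \<otimes> inv u" u K] V assms(3) by (simp add: m_assoc)
    then show ?thesis
      using that assms by (auto simp: conj_class_def subgroup.m_closed subgroup.m_inv_closed)
  qed
  ultimately show ?thesis unfolding conj_class_def by blast
qed

text \<open>Conjugation by an element of \<open>H1\<close> fixes \<open>H1\<close>. Together with
  \<open>conj_set_cong_l_coset\<close> this makes the class of an intersection depend only on the
  double coset of \<open>g\<close> with respect to \<open>H1\<close> and \<open>H2\<close>.\<close>

lemma conj_set_Int_conj_set:
  assumes "subgroup H1 G" "H2 \<subseteq> carrier G" "u \<in> H1" "g \<in> carrier G"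
  shows "conj_set G u (H1 \<inter> conj_set G g H2) = H1 \<inter> conj_set G (u \<otimes> g) H2"
proof -
  have "H1 \<subseteq> carrier G" "u \<in> carrier G" using assms subgroup.subset[OF assms(1)] by auto
  then show ?thesis
    using assms conj_set_subset[OF assms(4,2)]
    by (simp add: conj_set_Int conj_set_conj_set conj_set_self)
qed

lemma l_coset_eq_iff:
  assumes "subgroup H G" "a \<in> carrier G" "b \<in> carrier G"
  shows "a <# H = b <# H \<longleftrightarrow> inv a \<otimes> b \<in> H"
proof
  have H: "H \<subseteq> carrier G" using assms(1) by (rule subgroup.subset)
  {
    assume "a <# H = b <# H"
    moreover have "b \<in> b <# H" using assms H by (simp add: mem_l_coset subgroup.one_closed)
    ultimately have "b \<in> a <# H" by simp
    then show "inv a \<otimes> b \<in> H" using assms H by (simp add: mem_l_coset)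
  next
    assume ab: "inv a \<otimes> b \<in> H"
    have "x \<in> a <# H \<longleftrightarrow> x \<in> b <# H" if x: "x \<in> carrier G" for x
    proof -
      have "inv a \<otimes> x = (inv a \<otimes> b) \<otimes> (inv b \<otimes> x)" "inv b \<otimes> x = inv (inv a \<otimes> b) \<otimes> (inv a \<otimes> x)"
        using x assms by (simp_all add: m_assoc inv_mult_cancel inv_mult_group)
      then have "inv a \<otimes> x \<in> H \<longleftrightarrow> inv b \<otimes> x \<in> H"
        using ab assms(1) by (metis subgroup.m_closed subgroup.m_inv_closed)
      then show ?thesis using x assms H by (simp add: mem_l_coset)
    qed
    then show "a <# H = b <# H" using mem_l_coset[OF assms(2) H] mem_l_coset[OF assms(3) H] by blast
  }
qed

lemma conj_set_cong_l_coset: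
  assumes "subgroup H G" "a \<in> carrier G" "b \<in> carrier G" "inv a \<otimes> b \<in> H"
  shows "conj_set G a H = conj_set G b H"
proof -
  have "b = a \<otimes> (inv a \<otimes> b)" using assms by (simp add: inv_mult_cancel)
  then have "conj_set G b H = conj_set G a (conj_set G (inv a \<otimes> b) H)"
    using conj_set_conj_set[of a "inv a \<otimes> b" H] assms subgroup.subset[OF assms(1)] by simp
  then show ?thesis using conj_set_self[OF assms(1,4)] by simp
qed

end

context cayley_graph
begin

lemma quasiconvex_l_coset:
  assumes "quasiconvex \<sigma> S" "g \<in> carrier G"
  shows "quasiconvex \<sigma> (g <# S)"
  unfolding quasiconvex_def
proof (intro conjI ballI)
  have S: "S \<subseteq> carrier G" using assms(1) by (simp add: quasiconvex_def)
  show "g <# S \<subseteq> carrier G" using assms S by (auto simp: mem_l_coset)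
  fix a b v assume ab: "a \<in> g <# S" "b \<in> g <# S" and v: "v \<in> between a b"
  have V: "a \<in> carrier G" "b \<in> carrier G" "inv g \<otimes> a \<in> S" "inv g \<otimes> b \<in> S" "v \<in> carrier G"
    using ab assms S between_subset[OF v] by (auto simp: mem_l_coset)
  have "inv g \<otimes> v \<in> between (inv g \<otimes> a) (inv g \<otimes> b)" using between_translate[of "inv g" a b v] V v assms by simp
  then obtain s where s: "s \<in> S" "d (inv g \<otimes> v) s \<le> \<sigma>"
    using assms(1) V unfolding quasiconvex_def by blast
  have "s \<in> carrier G" using s S by auto
  then have "d v (g \<otimes> s) \<le> \<sigma>"
    using s dist_translate[of g "inv g \<otimes> v" s] V assms(2) by (simp add: inv_mult_cancel)
  then show "\<exists>s\<in>g <# S. d v s \<le> \<sigma>" using s unfolding l_coset_def by blast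
qed

lemma locally_finite_subset:
  assumes "locally_finite H" "K \<subseteq> H"
  shows "locally_finite K"
  unfolding locally_finite_def
proof
  fix r
  have "{h \<in> K. d \<one> h \<le> r} \<subseteq> {h \<in> H. d \<one> h \<le> r}" using assms(2) by blast
  then show "finite {h \<in> K. d \<one> h \<le> r}"
    using assms(1) unfolding locally_finite_def by (blast intro: finite_subset)
qed

lemma quasiconvex_mono: "quasiconvex \<sigma> S \<Longrightarrow> \<sigma> \<le> \<tau> \<Longrightarrow> quasiconvex \<tau> S"
  unfolding quasiconvex_def by (meson le_trans)

end

section \<open>Intersections of two separated quasiconvex subgroups\<close>

locale separated_subgroups = cayley_graph +
  fixes H1 H2 :: "'a set" and \<delta> \<sigma> :: nat
  assumes slim: "slim \<delta>"
    and H1: "subgroup H1 G" "locally_finite H1" "quasiconvex \<sigma> H1" "separated 1 (\<lambda>_. H1)"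
    and H2: "subgroup H2 G" "quasiconvex \<sigma> H2" "separated 1 (\<lambda>_. H2)"
begin

lemma H1_subset: "H1 \<subseteq> carrier G" and H2_subset: "H2 \<subseteq> carrier G"
  using H1 H2 by (auto dest: subgroup.subset)

text \<open>The cosets that accompany \<open>H1\<close> from the identity to some element
  \<open>u\<close>: \<open>R\<close> keeps \<open>u\<close> far enough for separation to apply, and
  \<open>R'\<close> keeps it in a finite ball. Cosets are collected instead of representatives so
  that the collection can be finite.\<close>

definition close_cosets :: "nat \<Rightarrow> nat \<Rightarrow> nat \<Rightarrow> 'a set set" where
  "close_cosets \<rho> R R' = {t <# H2 |t. t \<in> carrier G \<and> (\<exists>c\<in>t <# H2. d \<one> c \<le> \<rho>) \<and>
     (\<exists>u\<in>H1. R \<le> d \<one> u \<and> d \<one> u \<le> R' \<and> (\<exists>c\<in>t <# H2. d u c \<le> \<rho>))}"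

text \<open>A far element \<open>u\<close> determines the coset: two cosets close to both
  \<open>\<one>\<close> and \<open>u\<close> are \<open>2 * \<rho>\<close>-close to each other at
  two distant places, and separation of \<open>H2\<close> identifies them. It remains to count the
  elements \<open>u\<close> in a ball of \<open>H1\<close>.\<close>

lemma finite_close_cosets:
  obtains R where "\<And>R'. finite (close_cosets \<rho> R R')"
proof -
  obtain R where R: "separated_at 1 (\<lambda>_. H2) (2 * \<rho>) R" using H2(3) unfolding separated_def by blast
  \<comment> \<open>The margin \<open>2 * \<rho>\<close> is lost in passing from
    \<open>\<one>\<close> and \<open>u\<close> to the nearby points of the coset.\<close>
  define P where "P C u \<longleftrightarrow> (\<exists>t\<in>carrier G. C = t <# H2) \<and> (\<exists>c\<in>C. d \<one> c \<le> \<rho>) \<and>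
    R + 2 * \<rho> \<le> d \<one> u \<and> (\<exists>c\<in>C. d u c \<le> \<rho>)" for C u
  have unique: "C = C'" if C: "P C u" "P C' u" and u: "u \<in> carrier G" for C C' u
  proof -
    obtain t t' where t: "t \<in> carrier G" "C = t <# H2" "t' \<in> carrier G" "C' = t' <# H2"
      using C unfolding P_def by blast
    obtain a b where a: "a \<in> H2" "d \<one> (t \<otimes> a) \<le> \<rho>" and b: "b \<in> H2" "d u (t \<otimes> b) \<le> \<rho>"
      using C(1) unfolding P_def t(2) bex_l_coset by blast
    obtain a' b' where a': "a' \<in> H2" "d \<one> (t' \<otimes> a') \<le> \<rho>" and b': "b' \<in> H2" "d u (t' \<otimes> b') \<le> \<rho>"
      using C(2) unfolding P_def t(4) bex_l_coset by blast
    have V: "a \<in> carrier G" "b \<in> carrier G" "a' \<in> carrier G" "b' \<in> carrier G"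
      using a b a' b' H2_subset by auto
    have shift: "d x (inv t \<otimes> t' \<otimes> y) = d (t \<otimes> x) (t' \<otimes> y)" if "x \<in> carrier G" "y \<in> carrier G" for x y
      using dist_translate[of t x "inv t \<otimes> t' \<otimes> y"] t that by (simp add: m_assoc inv_mult_cancel)
    have two: "d x y \<le> 2 * \<rho>" if "d z x \<le> \<rho>" "d z y \<le> \<rho>" "x \<in> carrier G" "y \<in> carrier G" "z \<in> carrier G" for x y z
      using that dist_triangle[of x z y] dist_sym[of x z] by linarith
    have "d a (inv t \<otimes> t' \<otimes> a') \<le> 2 * \<rho>" "d b (inv t \<otimes> t' \<otimes> b') \<le> 2 * \<rho>"
      unfolding shift[OF V(1,3)] shift[OF V(2,4)] using a a' b b' V t u by (auto intro!: two)
    moreover have "R \<le> d a b"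
    proof -
      have "d a b = d (t \<otimes> a) (t \<otimes> b)" using dist_translate t V by simp
      moreover have "R + 2 * \<rho> \<le> d \<one> u" using C(1) unfolding P_def by blast
      moreover have "d \<one> u \<le> d \<one> (t \<otimes> a) + d (t \<otimes> a) (t \<otimes> b) + d (t \<otimes> b) u"
        using t V u by (intro dist_triangle3) auto
      ultimately show ?thesis using a b dist_sym[of "t \<otimes> b" u] t V u by simp
    qed
    ultimately have "inv t \<otimes> t' \<in> H2" using separated_at_singleD[OF R, of "inv t \<otimes> t'" a b a' b'] a b a' b' t by simp
    then show ?thesis using l_coset_eq_iff[OF H2(1)] t by simp
  qed
  have "finite (close_cosets \<rho> (R + 2 * \<rho>) R')" for R'
  proof (rule finite_subset)
    show "close_cosets \<rho> (R + 2 * \<rho>) R' \<subseteq> (\<lambda>u. SOME C. P C u) ` {u \<in> H1. d \<one> u \<le> R'}"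
    proof
      fix C assume "C \<in> close_cosets \<rho> (R + 2 * \<rho>) R'"
      then obtain u where u: "u \<in> H1" "d \<one> u \<le> R'" "P C u"
        unfolding close_cosets_def P_def by blast
      have "P (SOME C. P C u) u" using u(3) by (rule someI)
      then have "C = (SOME C. P C u)" using unique[OF u(3)] u(1) H1_subset by blast
      then show "C \<in> (\<lambda>u. SOME C. P C u) ` {u \<in> H1. d \<one> u \<le> R'}" using u by blast
    qed
    show "finite ((\<lambda>u. SOME C. P C u) ` {u \<in> H1. d \<one> u \<le> R'})"
      using H1(2) unfolding locally_finite_def by blast
  qed
  then show ?thesis using that by blast
qed

text \<open>Left translation by \<open>inv u\<close> preserves \<open>H1\<close> and the metric, so
  companions of \<open>H1\<close> anywhere in the group are moved to the identity.\<close>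

lemma in_close_cosets:
  assumes "g \<in> carrier G" "u \<in> H1" "u' \<in> H1" "c \<in> g <# H2" "c' \<in> g <# H2"
    and "d u c \<le> \<rho>" "d u' c' \<le> \<rho>" "R \<le> d u u'" "d u u' \<le> R'"
  shows "(inv u \<otimes> g) <# H2 \<in> close_cosets \<rho> R R'"
proof -
  have V: "u \<in> carrier G" "u' \<in> carrier G" "c \<in> carrier G" "c' \<in> carrier G"
    using assms H1_subset H2_subset by (auto simp: mem_l_coset)
  have coset: "inv u \<otimes> x \<in> (inv u \<otimes> g) <# H2" if "x \<in> g <# H2" for x
    using that V assms(1) H2_subset by (simp add: mem_l_coset inv_mult_translate)
  have "d \<one> (inv u \<otimes> c) \<le> \<rho>" "d (inv u \<otimes> u') (inv u \<otimes> c') \<le> \<rho>"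
    using dist_one_inv_mult[of u c] dist_translate[of "inv u" u' c'] V assms by auto
  moreover have "inv u \<otimes> u' \<in> H1" using assms H1(1) by (simp add: subgroup.m_closed subgroup.m_inv_closed)
  moreover have "d \<one> (inv u \<otimes> u') = d u u'" using dist_one_inv_mult V by simp
  ultimately have "\<exists>u''\<in>H1. R \<le> d \<one> u'' \<and> d \<one> u'' \<le> R' \<and> (\<exists>c\<in>(inv u \<otimes> g) <# H2. d u'' c \<le> \<rho>)"
    "\<exists>c\<in>(inv u \<otimes> g) <# H2. d \<one> c \<le> \<rho>"
    using assms(8,9) coset[OF assms(4)] coset[OF assms(5)] by (metis, metis)
  then show ?thesis unfolding close_cosets_def using V assms(1) by blast
qed

lemma intersection_subset: "H1 \<inter> conj_set G g H2 \<subseteq> carrier G"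
  using H1_subset by blast

text \<open>Consider the quadrilateral with corners \<open>\<one>\<close>, \<open>g\<close>,
  \<open>h \<otimes> g\<close>, \<open>h\<close>. The corners \<open>g\<close> and
  \<open>h \<otimes> g\<close> lie in the coset because \<open>h\<close> is in the conjugate, and
  the sides joining them to the geodesic have length \<open>d \<one> g\<close>. For these sides two
  distances are recorded: the one to the coset serves quasiconvexity, the one to the end of the
  geodesic serves the count of classes.\<close>

lemma between_close_to_coset:
  assumes g: "g \<in> carrier G" and h: "h \<in> conj_set G g H2" and v: "v \<in> between \<one> h"
  shows "(\<exists>c\<in>g <# H2. d v c \<le> 2 * \<delta> + \<sigma>) \<or> d v g \<le> 2 * \<delta> + d \<one> g \<and> d v \<one> \<le> 2 * \<delta> + d \<one> g \<or>
    d v (h \<otimes> g) \<le> 2 * \<delta> + d \<one> g \<and> d v h \<le> 2 * \<delta> + d \<one> g"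
proof -
  have hG: "h \<in> carrier G" "inv g \<otimes> h \<otimes> g \<in> H2" using h mem_conj_set[OF g H2_subset] by auto
  have vV: "v \<in> carrier G" using v between_subset by blast
  have c: "g \<in> g <# H2" "h \<otimes> g \<in> g <# H2"
    using g hG H2_subset H2(1) by (simp_all add: mem_l_coset subgroup.one_closed m_assoc)
  have hg: "d h (h \<otimes> g) = d \<one> g" using dist_translate[of h \<one> g] g hG by simp
  obtain q where q: "q \<in> between \<one> g \<union> between g (h \<otimes> g) \<union> between (h \<otimes> g) h" "d v q \<le> 2 * \<delta>"
    using slim_quadrilateral[OF slim _ _ _ _ v] g hG by (meson m_closed one_closed)
  have qV: "q \<in> carrier G" using q between_subset by blast
  consider "q \<in> between \<one> g" | "q \<in> between g (h \<otimes> g)" | "q \<in> between (h \<otimes> g) h" using q by blast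
  then show ?thesis
  proof cases
    case 1
    then have "d \<one> q + d q g = d \<one> g" by (simp add: between_def)
    then show ?thesis
      using dist_triangle[OF vV qV g] dist_triangle[OF vV qV one_closed] dist_sym[OF qV one_closed] q(2) by linarith
  next
    case 2
    then obtain c' where c': "c' \<in> g <# H2" "d q c' \<le> \<sigma>"
      using quasiconvex_l_coset[OF H2(2) g] c unfolding quasiconvex_def by blast
    then have "c' \<in> carrier G" using H2_subset g by (simp add: mem_l_coset)
    then have "d v c' \<le> 2 * \<delta> + \<sigma>" using dist_triangle[OF vV qV] q(2) c'(2) by fastforce
    then show ?thesis using c' by blast
  next
    case 3
    have V: "h \<otimes> g \<in> carrier G" using hG g by simp
    have "d (h \<otimes> g) q + d q h = d \<one> g"
      using 3 hg dist_sym[OF hG(1) V] by (simp add: between_def)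
    then show ?thesis
      using dist_triangle[OF vV qV hG(1)] dist_triangle[OF vV qV V] dist_sym[OF qV V] q(2) by linarith
  qed
qed

text \<open>The coset \<open>(inv u \<otimes> g) <# H2\<close> records how \<open>g <# H2\<close> is
  seen from \<open>u\<close>. Only finitely many such states occur along geodesics of length more
  than \<open>2 * L\<close>. If \<open>u\<close> and \<open>a\<close> in \<open>H1\<close> have the
  same state, then \<open>u \<otimes> inv a\<close> lies in the intersection, at distance
  \<open>d \<one> a\<close> from \<open>u\<close>; so one fixed \<open>a\<close> for every state
  suffices.\<close>

lemma quasiconvex_intersection:
  assumes g: "g \<in> carrier G"
  shows "\<exists>\<tau>. quasiconvex \<tau> (H1 \<inter> conj_set G g H2)"
proof -
  let ?K = "H1 \<inter> conj_set G g H2"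
  have K: "subgroup ?K G" using subgroups_Inter_pair H1(1) subgroup_conj_set[OF H2(1) g] by blast
  \<comment> \<open>The summand \<open>d \<one> g\<close> absorbs the two short sides of the
    quadrilateral. The constant may depend on \<open>g\<close> because one intersection is treated
    at a time.\<close>
  define \<rho> where "\<rho> = 2 * \<delta> + 2 * \<sigma> + d \<one> g"
  obtain R where R: "\<And>R'. finite (close_cosets \<rho> R R')" using finite_close_cosets[of \<rho>] by blast
  define L where "L = R + 2 * \<sigma>"
  define CC where "CC = close_cosets \<rho> R (L + 2 * \<sigma>)"
  define rep where "rep C = (SOME a. a \<in> H1 \<and> (inv a \<otimes> g) <# H2 = C)" for C
  define m where "m = Max (insert 0 ((\<lambda>C. d \<one> (rep C)) ` CC))"
  define \<tau> where "\<tau> = \<sigma> + m + 2 * L"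
  have base: "\<exists>k\<in>?K. d v k \<le> \<tau>" if h: "h \<in> ?K" and v: "v \<in> between \<one> h" for h v
  proof (cases "d \<one> h \<le> 2 * L")
    case True
    have "h \<in> carrier G" "v \<in> carrier G" using h H1_subset between_subset[OF v] by auto
    then have "d v \<one> \<le> 2 * L" using v True dist_sym[of v \<one>] by (simp add: between_def)
    then show ?thesis using subgroup.one_closed[OF K] by (intro bexI[of _ \<one>]) (auto simp: \<tau>_def)
  next
    case False
    have V: "h \<in> carrier G" "v \<in> carrier G" using h H1_subset between_subset[OF v] by auto
    have close: "\<exists>u\<in>H1. d w u \<le> \<sigma> \<and> (\<exists>c\<in>g <# H2. d u c \<le> \<rho>)" if w: "w \<in> between \<one> h" for w
    proof -
      have wV: "w \<in> carrier G" using w between_subset by blast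
      obtain u where u: "u \<in> H1" "d w u \<le> \<sigma>"
        using H1(3) w h subgroup.one_closed[OF H1(1)] unfolding quasiconvex_def by blast
      have uV: "u \<in> carrier G" using u H1_subset by auto
      have "g \<in> g <# H2" "h \<otimes> g \<in> g <# H2"
        using g h V H2_subset H2(1) mem_conj_set[OF g H2_subset] 
        by (simp_all add: mem_l_coset subgroup.one_closed m_assoc)
      then obtain c where c: "c \<in> g <# H2" "d w c \<le> 2 * \<delta> + \<sigma> + d \<one> g"
        using between_close_to_coset[OF g _ w] h by fastforce
      have "c \<in> carrier G" using c g H2_subset by (simp add: mem_l_coset)
      then have "d u c \<le> \<rho>"
        using dist_triangle[of u w c] dist_sym[OF uV wV] u c uV wV unfolding \<rho>_def by simp
      then show ?thesis using u c by blast
    qed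
    \<comment> \<open>On a geodesic longer than \<open>2 * L\<close> there is room for distance
      \<open>L\<close> on at least one side of \<open>v\<close>.\<close>
    have "\<exists>v'\<in>between \<one> h. d v v' = L"
    proof (cases "L \<le> d v h")
      case True
      then obtain v' where "v' \<in> between v h" "d v v' = L" using ex_between_at[OF V(2,1)] by blast
      then show ?thesis using between_sub'(1)[OF one_closed V(1) v] by blast
    next
      case False
      have "d v \<one> + d v h = d \<one> h" using v V dist_sym[of v \<one>] by (simp add: between_def)
      then have "L \<le> d v \<one>" using False \<open>\<not> d \<one> h \<le> 2 * L\<close> by linarith
      then obtain v' where v': "v' \<in> between v \<one>" "d v v' = L" using ex_between_at[OF V(2) one_closed] by blast
      then have "v' \<in> between \<one> v" using between_commute V by blast
      then show ?thesis using between_sub(1)[OF one_closed V(1) v] v' by blast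
    qed
    then obtain v' where v': "v' \<in> between \<one> h" "d v v' = L" by blast
    have v'V: "v' \<in> carrier G" using v' between_subset by blast
    obtain u c where u: "u \<in> H1" "d v u \<le> \<sigma>" "c \<in> g <# H2" "d u c \<le> \<rho>" using close[OF v] by blast
    obtain u' c' where u': "u' \<in> H1" "d v' u' \<le> \<sigma>" "c' \<in> g <# H2" "d u' c' \<le> \<rho>" using close[OF v'(1)] by blast
    have uV: "u \<in> carrier G" "u' \<in> carrier G" using u u' H1_subset by auto
    have uu': "R \<le> d u u'" "d u u' \<le> L + 2 * \<sigma>"
      using dist_triangle3[OF V(2) uV v'V] dist_triangle3[OF uV(1) V(2) v'V uV(2)]
        dist_sym[OF uV(1) V(2)] dist_sym[OF uV(2) v'V] u(2) u'(2) v'(2) by (simp_all add: L_def)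
    define C where "C = (inv u \<otimes> g) <# H2"
    have C: "C \<in> CC"
      unfolding C_def CC_def using in_close_cosets[OF g u(1) u'(1) u(3) u'(3) u(4) u'(4) uu'] .
    have rep: "rep C \<in> H1" "(inv (rep C) \<otimes> g) <# H2 = C"
      using someI[of "\<lambda>a. a \<in> H1 \<and> (inv a \<otimes> g) <# H2 = C" u] u(1) unfolding rep_def C_def by auto
    have repV: "rep C \<in> carrier G" using rep H1_subset by auto
    have "inv (inv u \<otimes> g) \<otimes> (inv (rep C) \<otimes> g) \<in> H2"
      using l_coset_eq_iff[OF H2(1), of "inv u \<otimes> g" "inv (rep C) \<otimes> g"] rep repV uV g by (simp add: C_def)
    then have "u \<otimes> inv (rep C) \<in> conj_set G g H2"
      using mem_conj_set[OF g H2_subset] uV repV g by (simp add: inv_mult_group m_assoc)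
    moreover have "u \<otimes> inv (rep C) \<in> H1"
      using u rep H1(1) by (simp add: subgroup.m_closed subgroup.m_inv_closed)
    moreover have "d v (u \<otimes> inv (rep C)) \<le> \<tau>"
    proof -
      have "d u (u \<otimes> inv (rep C)) = d \<one> (inv (rep C))"
        using dist_translate[of u \<one> "inv (rep C)"] uV repV by simp
      also have "\<dots> = d \<one> (rep C)" using dist_one_inv_mult[of "rep C" \<one>] repV dist_sym by simp
      also have "\<dots> \<le> m" unfolding m_def using C R unfolding CC_def by (intro Max_ge) auto
      finally show ?thesis
        using dist_triangle[of v u "u \<otimes> inv (rep C)"] V uV repV u(2) by (simp add: \<tau>_def)
    qed
    ultimately show ?thesis by blast
  qed
  have "\<exists>k\<in>?K. d v k \<le> \<tau>" if ab: "a \<in> ?K" "b \<in> ?K" and v: "v \<in> between a b" for a b v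
  proof -
    have V: "a \<in> carrier G" "b \<in> carrier G" "v \<in> carrier G" using ab H1_subset between_subset[OF v] by auto
    have "inv a \<otimes> b \<in> ?K" using ab K by (simp add: subgroup.m_closed subgroup.m_inv_closed del: Int_iff)
    moreover have "inv a \<otimes> v \<in> between \<one> (inv a \<otimes> b)"
      using between_translate[of "inv a" a b v] V v by simp
    ultimately obtain k where k: "k \<in> ?K" "d (inv a \<otimes> v) k \<le> \<tau>" using base by blast
    have kV: "k \<in> carrier G" using k H1_subset by auto
    have "d v (a \<otimes> k) \<le> \<tau>"
      using dist_translate[of a "inv a \<otimes> v" k] k V kV by (simp add: inv_mult_cancel)
    moreover have "a \<otimes> k \<in> ?K" using ab k K by (simp add: subgroup.m_closed del: Int_iff)
    ultimately show ?thesis by blast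
  qed
  then show ?thesis unfolding quasiconvex_def using H1_subset by blast
qed

text \<open>The optimal centres of \<open>K\<close> in \<open>H1\<close> are permuted by
  \<open>K\<close>, because left translation by an element of \<open>K\<close> preserves
  \<open>K\<close>, and by \<open>quasi_center\<close> they are close together. So a centre
  \<open>s\<close> is moved little by every \<open>k\<close>, which says that
  \<open>inv s \<otimes> k \<otimes> s\<close> is short.\<close>

lemma finite_intersection_conj_small:
  assumes K: "subgroup K G" "K \<subseteq> H1" "finite K"
  obtains u where "u \<in> H1" "conj_set G u K \<subseteq> {h \<in> H1. d \<one> h \<le> 4 * \<delta> + 2 * \<sigma> + 1}"
proof -
  have KG: "K \<subseteq> carrier G" using K H1_subset by auto
  have neK: "K \<noteq> {}" using subgroup.one_closed[OF K(1)] by blast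
  define rad where "rad s = Max (d s ` K)" for s
  obtain s where s: "s \<in> H1" "\<And>t. t \<in> H1 \<Longrightarrow> rad s \<le> rad t"
    using ex_has_least_nat[of "\<lambda>s. s \<in> H1" \<one> rad] subgroup.one_closed[OF H1(1)] by blast
  have sV: "s \<in> carrier G" using s H1_subset by auto
  have rad_ge: "d t f \<le> rad t" if "f \<in> K" for t f
    unfolding rad_def using that K(3) by (intro Max_ge) auto
  have "d s (k \<otimes> s) \<le> 4 * \<delta> + 2 * \<sigma> + 1" if k: "k \<in> K" for k
  proof (rule quasi_center[OF slim H1(3) KG s(1)])
    have kV: "k \<in> carrier G" using k KG by auto
    show "k \<otimes> s \<in> H1" using k s K H1(1) by (auto simp: subgroup.m_closed)
    show "\<forall>f\<in>K. d s f \<le> rad s" using rad_ge by blast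
    show "\<forall>f\<in>K. d (k \<otimes> s) f \<le> rad s"
    proof
      fix f assume f: "f \<in> K"
      then have "inv k \<otimes> f \<in> K" "f \<in> carrier G"
        using k K(1) KG by (auto simp: subgroup.m_closed subgroup.m_inv_closed)
      then show "d (k \<otimes> s) f \<le> rad s"
        using rad_ge[of "inv k \<otimes> f" s] dist_translate[of k s "inv k \<otimes> f"] kV sV by (simp add: inv_mult_cancel)
    qed
    show "\<forall>t\<in>H1. \<exists>f\<in>K. rad s \<le> d t f"
    proof
      fix t assume "t \<in> H1"
      moreover have "rad t \<in> d t ` K" unfolding rad_def using K(3) neK by (intro Max_in) auto
      ultimately show "\<exists>f\<in>K. rad s \<le> d t f" using s(2) by fastforce
    qed
  qed
  then have small: "d \<one> (inv s \<otimes> (k \<otimes> s)) \<le> 4 * \<delta> + 2 * \<sigma> + 1" if "k \<in> K" for k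
    using dist_one_inv_mult[of s "k \<otimes> s"] that KG sV by auto
  have u: "inv s \<in> H1" using s H1(1) by (simp add: subgroup.m_inv_closed)
  have "x \<in> H1 \<and> d \<one> x \<le> 4 * \<delta> + 2 * \<sigma> + 1" if "x \<in> conj_set G (inv s) K" for x
  proof
    have x: "x \<in> carrier G" "s \<otimes> x \<otimes> inv s \<in> K" using that mem_conj_set[of "inv s" K x] sV KG by auto
    have "inv s \<otimes> (s \<otimes> x \<otimes> inv s \<otimes> s) = x" using x sV by (simp add: m_assoc inv_mult_cancel)
    moreover have "inv s \<otimes> (s \<otimes> x \<otimes> inv s \<otimes> s) \<in> H1"
      using x K(2) s u H1(1) by (meson subgroup.m_closed subsetD)
    ultimately show "x \<in> H1" "d \<one> x \<le> 4 * \<delta> + 2 * \<sigma> + 1" using small[OF x(2)] by simp_all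
  qed
  then show ?thesis using that[OF u] by blast
qed

text \<open>A class either comes from one of the cosets in \<open>CC\<close> through
  \<open>F\<close> or is the class of a subset of the ball \<open>B\<close>. Both finite sets are
  fixed before \<open>g\<close> is chosen.\<close>

lemma finite_intersection_classes: "finite (intersection_classes G H1 H2)"
proof -
  \<comment> \<open>This constant has to serve all \<open>g\<close> at once, so it contains no term
    \<open>d \<one> g\<close>; vertices far from the ends of a geodesic are used instead.\<close>
  define \<rho> where "\<rho> = 2 * \<delta> + 2 * \<sigma>"
  obtain R where R: "\<And>R'. finite (close_cosets \<rho> R R')" using finite_close_cosets[of \<rho>] by blast
  define CC where "CC = close_cosets \<rho> R (R + 4 * \<sigma>)"
  define F where "F C = conj_class G H1 (H1 \<inter> conj_set G (SOME t. t \<in> carrier G \<and> t <# H2 = C) H2)" for C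
  define B where "B = {h \<in> H1. d \<one> h \<le> 4 * \<delta> + 2 * \<sigma> + 1}"
  have F: "F (t <# H2) = conj_class G H1 (H1 \<inter> conj_set G t H2)" if t: "t \<in> carrier G" for t
  proof -
    let ?t = "SOME t'. t' \<in> carrier G \<and> t' <# H2 = t <# H2"
    have t': "?t \<in> carrier G" "?t <# H2 = t <# H2"
      using someI[of "\<lambda>t'. t' \<in> carrier G \<and> t' <# H2 = t <# H2" t] t by auto
    then have "conj_set G ?t H2 = conj_set G t H2"
      using conj_set_cong_l_coset[OF H2(1) t'(1) t] l_coset_eq_iff[OF H2(1) t'(1) t] by blast
    then show ?thesis by (simp add: F_def)
  qed
  have "conj_class G H1 (H1 \<inter> conj_set G g H2) \<in> F ` CC \<union> conj_class G H1 ` Pow B"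
    if g: "g \<in> carrier G" for g
  proof -
    let ?K = "H1 \<inter> conj_set G g H2"
    have K: "subgroup ?K G" using subgroups_Inter_pair H1(1) subgroup_conj_set[OF H2(1) g] by blast
    \<comment> \<open>A vertex at distance at least \<open>k\<close> from both ends is out of reach
      of the two sides of length \<open>d \<one> g\<close> in
      \<open>between_close_to_coset\<close>.\<close>
    define k where "k = d \<one> g + 2 * \<delta> + 1"
    define L where "L = R + 2 * \<sigma>"
    show ?thesis
    \<comment> \<open>A bounded intersection is finite by local finiteness of \<open>H1\<close>.
      Otherwise some geodesic has room for a segment of length \<open>L\<close> at distance at least
      \<open>k\<close> from both ends.\<close>
    proof (cases "\<forall>h\<in>?K. d \<one> h \<le> 2 * k + L")
      case True
      have "locally_finite ?K" using locally_finite_subset[OF H1(2)] by blast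
      then have "finite {h \<in> ?K. d \<one> h \<le> 2 * k + L}" unfolding locally_finite_def by blast
      moreover have "{h \<in> ?K. d \<one> h \<le> 2 * k + L} = ?K" using True by blast
      ultimately have "finite ?K" by simp
      then obtain u where "u \<in> H1" "conj_set G u ?K \<subseteq> B"
        using finite_intersection_conj_small[OF K] unfolding B_def by blast
      then show ?thesis using conj_class_conj_set[OF H1(1) _ intersection_subset] by blast
    next
      case False
      then obtain h where h: "h \<in> ?K" "2 * k + L < d \<one> h" by auto
      have hV: "h \<in> carrier G" using h H1_subset by auto
      have close: "\<exists>u\<in>H1. d w u \<le> \<sigma> \<and> (\<exists>c\<in>g <# H2. d u c \<le> \<rho>)"
        if w: "w \<in> between \<one> h" "k \<le> d \<one> w" "k \<le> d w h" for w
      proof -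
        have wV: "w \<in> carrier G" using w between_subset by blast
        obtain u where u: "u \<in> H1" "d w u \<le> \<sigma>"
          using H1(3) w h subgroup.one_closed[OF H1(1)] unfolding quasiconvex_def by blast
        have uV: "u \<in> carrier G" using u H1_subset by auto
        obtain c where c: "c \<in> g <# H2" "d w c \<le> 2 * \<delta> + \<sigma>"
          using between_close_to_coset[OF g _ w(1)] h w(2,3) dist_sym[OF wV one_closed]
          unfolding k_def by fastforce
        have "c \<in> carrier G" using c g H2_subset by (simp add: mem_l_coset)
        then have "d u c \<le> \<rho>"
          using dist_triangle[of u w c] dist_sym[OF uV wV] u c uV wV unfolding \<rho>_def by simp
        then show ?thesis using u c by blast
      qed
      obtain v where v: "v \<in> between \<one> h" "d \<one> v = k" "d v h = d \<one> h - k"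
        using ex_between_at[OF one_closed hV, of k] h(2) by auto
      have vV: "v \<in> carrier G" using v between_subset by blast
      have "L \<le> d v h" using h(2) v(3) by linarith
      then obtain v' where v': "v' \<in> between v h" "d v v' = L" "d v' h = d v h - L"
        using ex_between_at[OF vV hV] by blast
      have v'V: "v' \<in> carrier G" using v' between_subset by blast
      note v'2 = between_sub'[OF one_closed hV v(1) v'(1)]
      have "k \<le> d \<one> v'" using v'2(2) v(2) by (simp add: between_def)
      obtain u c where u: "u \<in> H1" "d v u \<le> \<sigma>" "c \<in> g <# H2" "d u c \<le> \<rho>"
        using close[OF v(1)] v(2,3) h(2) by fastforce
      obtain u' c' where u': "u' \<in> H1" "d v' u' \<le> \<sigma>" "c' \<in> g <# H2" "d u' c' \<le> \<rho>"
        using close[OF v'2(1) \<open>k \<le> d \<one> v'\<close>] v(3) v'(3) h(2) by fastforce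
      have uV: "u \<in> carrier G" "u' \<in> carrier G" using u u' H1_subset by auto
      have uu': "R \<le> d u u'" "d u u' \<le> R + 4 * \<sigma>"
        using dist_triangle3[OF vV uV v'V] dist_triangle3[OF uV(1) vV v'V uV(2)]
          dist_sym[OF uV(1) vV] dist_sym[OF uV(2) v'V] u(2) u'(2) v'(2) by (simp_all add: L_def)
      have "(inv u \<otimes> g) <# H2 \<in> CC"
        unfolding CC_def using in_close_cosets[OF g u(1) u'(1) u(3) u'(3) u(4) u'(4) uu'] .
      moreover have "F ((inv u \<otimes> g) <# H2) = conj_class G H1 ?K"
      proof -
        have iu: "inv u \<in> H1" using u H1(1) by (simp add: subgroup.m_inv_closed)
        then show ?thesis
          using F[of "inv u \<otimes> g"] conj_set_Int_conj_set[OF H1(1) H2_subset iu g] uV g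
            conj_class_conj_set[OF H1(1) iu intersection_subset[of g]] by simp
      qed
      ultimately show ?thesis by blast
    qed
  qed
  then have "intersection_classes G H1 H2 \<subseteq> F ` CC \<union> conj_class G H1 ` Pow B"
    unfolding intersection_classes_def conj_intersections_def by blast
  moreover have "finite B" using H1(2) unfolding B_def locally_finite_def by blast
  moreover have "finite CC" unfolding CC_def by (rule R)
  ultimately show ?thesis by (meson finite_Pow_iff finite_UnI finite_imageI finite_subset)
qed

text \<open>Points of \<open>K i\<close> lie in \<open>H1\<close> and near \<open>g i <# H2\<close>.
  If \<open>K i\<close> fellow-travels with \<open>w <# K j\<close>, separation of the two subgroups
  forces \<open>w\<close> into \<open>H1\<close> and \<open>w \<otimes> g j\<close> into
  \<open>g i <# H2\<close>. Then conjugation by \<open>w\<close> takes \<open>K j\<close> to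
  \<open>K i\<close>, so \<open>i = j\<close> because classes have one representative each, and
  \<open>w\<close> lies in \<open>K i\<close>.\<close>

lemma separated_class_representatives:
  assumes reps: "class_representatives G H1 H2 n K"
  shows "separated n K"
proof -
  obtain g where g: "\<And>i. i \<in> {1..n} \<Longrightarrow> g i \<in> carrier G \<and> K i = H1 \<inter> conj_set G (g i) H2"
    using reps unfolding class_representatives_def conj_intersections_def image_iff by metis
  have inj: "inj_on (\<lambda>i. conj_class G H1 (K i)) {1..n}"
    using reps unfolding class_representatives_def bij_betw_def by blast
  \<comment> \<open>Replacing a point \<open>z\<close> of \<open>K i\<close> by its neighbour
    \<open>z \<otimes> g i\<close> in \<open>g i <# H2\<close> moves it by
    \<open>d \<one> (g i)\<close>; \<open>m\<close> bounds this for the whole family, and the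
    inserted 0 covers \<open>n = 0\<close>.\<close>
  define m where "m = Max (insert 0 ((\<lambda>i. d \<one> (g i)) ` {1..n}))"
  have m: "d \<one> (g i) \<le> m" if "i \<in> {1..n}" for i
    unfolding m_def using that by (intro Max_ge) auto
  show ?thesis
    unfolding separated_def
  proof
    fix \<epsilon>
    obtain R1 where R1: "separated_at 1 (\<lambda>_. H1) \<epsilon> R1" using H1(4) unfolding separated_def by blast
    obtain R2 where R2: "separated_at 1 (\<lambda>_. H2) (\<epsilon> + 2 * m) R2" using H2(3) unfolding separated_def by blast
    have "i = j \<and> w \<in> K i" if w: "w \<in> carrier G" and ij: "i \<in> {1..n}" "j \<in> {1..n}"
      and xy: "x \<in> K i" "y \<in> K i" "x' \<in> K j" "y' \<in> K j"
      and close: "d x (w \<otimes> x') \<le> \<epsilon>" "d y (w \<otimes> y') \<le> \<epsilon>" and far: "R1 + (R2 + 2 * m) \<le> d x y"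
      for w i j x y x' y'
    proof -
      let ?a = "g i" and ?b = "g j"
      have ab: "?a \<in> carrier G" "?b \<in> carrier G" using g ij by auto
      have Ki: "z \<in> H1" "inv ?a \<otimes> z \<otimes> ?a \<in> H2" if "z \<in> K i" for z
        using that g[OF ij(1)] mem_conj_set[OF ab(1) H2_subset] by auto
      have Kj: "z \<in> H1" "inv ?b \<otimes> z \<otimes> ?b \<in> H2" if "z \<in> K j" for z
        using that g[OF ij(2)] mem_conj_set[OF ab(2) H2_subset] by auto
      have V: "x \<in> carrier G" "y \<in> carrier G" "x' \<in> carrier G" "y' \<in> carrier G"
        using Ki[OF xy(1)] Ki[OF xy(2)] Kj[OF xy(3)] Kj[OF xy(4)] H1_subset by auto
      have wH: "w \<in> H1"
        using separated_at_singleD[OF R1 w, of x y x' y'] Ki(1)[OF xy(1)] Ki(1)[OF xy(2)] Kj(1)[OF xy(3)] Kj(1)[OF xy(4)] close far by simp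
      have shift: "d (inv ?a \<otimes> z \<otimes> ?a) (inv ?a \<otimes> w \<otimes> ?b \<otimes> (inv ?b \<otimes> z' \<otimes> ?b)) \<le> \<epsilon> + 2 * m"
        if z: "z \<in> carrier G" "z' \<in> carrier G" "d z (w \<otimes> z') \<le> \<epsilon>" for z z'
      proof -
        have "d (inv ?a \<otimes> z \<otimes> ?a) (inv ?a \<otimes> w \<otimes> ?b \<otimes> (inv ?b \<otimes> z' \<otimes> ?b)) = d (z \<otimes> ?a) (w \<otimes> z' \<otimes> ?b)"
          using dist_translate[of "inv ?a" "z \<otimes> ?a" "w \<otimes> z' \<otimes> ?b"] ab w z
          by (simp add: m_assoc inv_mult_cancel)
        also have "\<dots> \<le> d (z \<otimes> ?a) z + d z (w \<otimes> z') + d (w \<otimes> z') (w \<otimes> z' \<otimes> ?b)"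
          using ab w z by (intro dist_triangle3) auto
        also have "d (w \<otimes> z') (w \<otimes> z' \<otimes> ?b) = d \<one> ?b"
          using dist_translate[of "w \<otimes> z'" \<one> ?b] ab w z by simp
        also have "d (z \<otimes> ?a) z = d \<one> ?a"
          using dist_translate[of z \<one> ?a] dist_sym[of "z \<otimes> ?a" z] ab z by simp
        finally show ?thesis using m[OF ij(1)] m[OF ij(2)] z(3) by linarith
      qed
      have "R2 \<le> d (inv ?a \<otimes> x \<otimes> ?a) (inv ?a \<otimes> y \<otimes> ?a)"
      proof -
        have "d (inv ?a \<otimes> x \<otimes> ?a) (inv ?a \<otimes> y \<otimes> ?a) = d (x \<otimes> ?a) (y \<otimes> ?a)"
          using dist_translate[of "inv ?a" "x \<otimes> ?a" "y \<otimes> ?a"] ab V by (simp add: m_assoc)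
        moreover have "d x y \<le> d x (x \<otimes> ?a) + d (x \<otimes> ?a) (y \<otimes> ?a) + d (y \<otimes> ?a) y"
          using ab V by (intro dist_triangle3) auto
        moreover have "d x (x \<otimes> ?a) = d \<one> ?a" using dist_translate[of x \<one> ?a] ab V by simp
        moreover have "d (y \<otimes> ?a) y = d \<one> ?a"
          using dist_translate[of y \<one> ?a] dist_sym[of "y \<otimes> ?a" y] ab V by simp
        ultimately show ?thesis using far m[OF ij(1)] by linarith
      qed
      then have awb: "inv ?a \<otimes> w \<otimes> ?b \<in> H2"
        using separated_at_singleD[OF R2 _ Ki(2)[OF xy(1)] Ki(2)[OF xy(2)] Kj(2)[OF xy(3)] Kj(2)[OF xy(4)]
            shift[OF V(1,3) close(1)] shift[OF V(2,4) close(2)]] ab w by simp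
      have "conj_set G ?a H2 = conj_set G (w \<otimes> ?b) H2"
        using conj_set_cong_l_coset[OF H2(1), of ?a "w \<otimes> ?b"] ab w awb by (simp add: m_assoc)
      then have "conj_set G w (K j) = K i"
        using g[OF ij(1)] g[OF ij(2)] conj_set_Int_conj_set[OF H1(1) H2_subset wH ab(2)] by simp
      then have "conj_class G H1 (K i) = conj_class G H1 (K j)"
        using conj_class_conj_set[OF H1(1) wH, of "K j"] g[OF ij(2)] intersection_subset by simp
      then have "i = j" using inj ij by (auto dest: inj_onD)
      then show ?thesis using awb wH w g[OF ij(1)] mem_conj_set[OF ab(1) H2_subset] by simp
    qed
    then have "separated_at n K \<epsilon> (R1 + (R2 + 2 * m))" unfolding separated_at_def by blast
    then show "\<exists>R. separated_at n K \<epsilon> R" ..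
  qed
qed

end

section \<open>Relative hyperbolicity\<close>

lemma rel_dist_le_iff:
  "rel_dist G X n Q i a b \<le> enat r \<longleftrightarrow> (\<exists>m\<le>r. (a, b) \<in> rel_edges G X n Q i ^^ m)"
proof
  assume le: "rel_dist G X n Q i a b \<le> enat r"
  show "\<exists>m\<le>r. (a, b) \<in> rel_edges G X n Q i ^^ m"
  proof (rule ccontr)
    assume "\<not> ?thesis"
    then have "enat (Suc r) \<le> rel_dist G X n Q i a b"
      unfolding rel_dist_def by (intro INF_greatest) (auto simp: not_less_eq_eq[symmetric])
    then have "enat (Suc r) \<le> enat r" using le by (rule order_trans)
    then show False by simp
  qed
next
  assume "\<exists>m\<le>r. (a, b) \<in> rel_edges G X n Q i ^^ m"
  then obtain m where "m \<le> r" "(a, b) \<in> rel_edges G X n Q i ^^ m" by blast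
  then show "rel_dist G X n Q i a b \<le> enat r"
    unfolding rel_dist_def by (intro INF_lower2[of m]) auto
qed

lemma pigeonhole_label:
  fixes f :: "nat \<Rightarrow> nat"
  assumes "\<And>s. s \<le> r \<Longrightarrow> f s < m" "m \<le> r"
  obtains s s' where "s < s'" "s' \<le> r" "f s = f s'"
proof -
  have "card (f ` {..r}) \<le> card {..<m}" using assms(1) by (intro card_mono) auto
  then have "\<not> inj_on f {..r}" using assms(2) by (intro pigeonhole) simp
  then obtain s s' where "s \<le> r" "s' \<le> r" "s \<noteq> s'" "f s = f s'" unfolding inj_on_def by auto
  then show ?thesis using that[of s s'] that[of s' s] by (cases "s < s'") auto
qed

section \<open>Relative metrics and the coned-off graph\<close>

context cayley_graph
begin

text \<open>An edge labelled in \<open>K i\<close> ends in \<open>K i\<close> as soon as it starts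
  there, so the exclusion in \<open>rel_edges\<close> can be tested at the start. Closure under
  inverses allows peripheral labels to be recorded in one orientation.\<close>

lemma rel_edges_subgroup:
  assumes H: "subgroup H G" and K: "\<And>j. j \<in> {1..n} \<Longrightarrow> subgroup (K j) G"
    and e: "(a, b) \<in> rel_edges (G\<lparr>carrier := H\<rparr>) Y n K i"
  shows "a \<in> H \<and> b \<in> H \<and> (inv a \<otimes> b \<in> Y \<or> inv b \<otimes> a \<in> Y \<or>
    (\<exists>j\<in>{1..n}. inv a \<otimes> b \<in> K j \<and> \<not> (j = i \<and> a \<in> K i)))"
proof -
  consider "(a, b) \<in> cayley (G\<lparr>carrier := H\<rparr>) Y"
    | j where "j \<in> {1..n}" "(a, b) \<in> cayley (G\<lparr>carrier := H\<rparr>) (K j)" "\<not> (j = i \<and> a \<in> K i \<and> b \<in> K i)"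
    using e unfolding rel_edges_def by blast
  then show ?thesis
  proof cases
    case 1
    then show ?thesis using cayley_subgroup[OF H] by (auto simp: cayley_def)
  next
    case 2
    then have ab: "a \<in> H" "b \<in> H" "a \<in> carrier G" "b \<in> carrier G" "(a, b) \<in> cayley G (K j)"
      using cayley_subgroup[OF H] by (auto simp: cayley_def)
    have "inv a \<otimes> b \<in> K j"
    proof (rule cayley_subgroup_closed[OF K[OF 2(1)] subset_refl subgroup.one_closed[OF K[OF 2(1)]]])
      show "(\<one>, inv a \<otimes> b) \<in> cayley G (K j)"
        using cayley_translate[of "inv a" a b "K j"] ab by simp
    qed
    moreover have "\<not> (j = i \<and> a \<in> K i)"
    proof
      assume "j = i \<and> a \<in> K i"
      then have "b \<in> K i" using cayley_subgroup_closed[OF K[OF 2(1)] subset_refl _ ab(5)] by simp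
      then show False using 2(3) \<open>j = i \<and> a \<in> K i\<close> by blast
    qed
    ultimately show ?thesis using ab 2(1) by blast
  qed
qed

text \<open>A path of bounded length is a polygon with boundedly many sides. A long geodesic joining its
  ends stays close to it, so a long piece of the geodesic fellow-travels with a single side, which
  then has to be a peripheral edge of the same coset by separation.\<close>

lemma rel_path_bounded:
  assumes slim: "slim \<delta>" and H: "subgroup H G"
    and K: "\<And>j. j \<in> {1..n} \<Longrightarrow> subgroup (K j) G"
    and qc: "\<And>j. j \<in> {1..n} \<Longrightarrow> quasiconvex \<tau> (K j)"
    and sep: "separated n K"
    and Y: "Y \<subseteq> carrier G" "\<And>y. y \<in> Y \<Longrightarrow> d \<one> y \<le> M" and i: "i \<in> {1..n}"
  shows "\<exists>B. \<forall>a\<in>K i. \<forall>b\<in>K i. \<forall>m\<le>r.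
    (a, b) \<in> rel_edges (G\<lparr>carrier := H\<rparr>) Y n K i ^^ m \<longrightarrow> d a b \<le> B"
proof -
  \<comment> \<open>The way from \<open>K i\<close> to the geodesic costs \<tau>, from there to a
    side of the polygon \<open>r * \<delta>\<close>, and from the side to its coset \<tau>
    again.\<close>
  obtain R where R: "separated_at n K (2 * \<tau> + r * \<delta>) R" using sep unfolding separated_def by blast
  \<comment> \<open>\<open>R + 2 * \<tau>\<close> leaves distance \<open>R\<close> between nearby
    points of \<open>K i\<close>; the other summands exclude sides of length at most
    \<open>M\<close>.\<close>
  define P where "P = R + 2 * \<tau> + 2 * (r * \<delta> + M) + 1"
  have HG: "H \<subseteq> carrier G" using H by (rule subgroup.subset)
  have KG: "K j \<subseteq> carrier G" if "j \<in> {1..n}" for j using K[OF that] by (rule subgroup.subset)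
  have "d a b \<le> r * P" if ab: "a \<in> K i" "b \<in> K i" and m: "m \<le> r"
    and path: "(a, b) \<in> rel_edges (G\<lparr>carrier := H\<rparr>) Y n K i ^^ m" for a b m
  proof (rule ccontr)
    assume "\<not> d a b \<le> r * P"
    then have far: "r * P < d a b" by simp
    have abG: "a \<in> carrier G" "b \<in> carrier G" using ab KG[OF i] by auto
    obtain x where x: "x 0 = a" "x m = b" "\<And>l. l < m \<Longrightarrow> (x l, x (Suc l)) \<in> rel_edges (G\<lparr>carrier := H\<rparr>) Y n K i"
      using path unfolding relpow_fun_conv by blast
    have "m \<noteq> 0" using far x(1,2) abG by (metis dist_self not_less0)
    note edge = rel_edges_subgroup[OF H K x(3)]
    have xG: "x l \<in> carrier G" if "l \<le> m" for l
    proof (cases "l = 0")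
      case False
      then obtain l' where "l = Suc l'" by (cases l) auto
      then show ?thesis using edge[of l'] that HG by auto
    qed (use x abG in simp)
    obtain p where p: "p 0 = a" "p (d a b) = b" "\<forall>s\<le>d a b. p s \<in> carrier G"
      "\<forall>s t. s \<le> t \<longrightarrow> t \<le> d a b \<longrightarrow> d (p s) (p t) = t - s"
      using ex_geodesic[OF abG] by blast
    have sP: "s * P \<le> d a b" if "s \<le> r" for s
      using mult_le_mono1[OF that, of P] far by linarith
    \<comment> \<open>There are \<open>r + 1\<close> sample points at spacing \<open>P\<close> and
      at most \<open>r\<close> sides, so two samples are close to the same side.\<close>
    define w where "w s = p (s * P)" for s
    have wG: "w s \<in> carrier G" and wI: "w s \<in> between a b" if "s \<le> r" for s
      using p(3) sP[OF that] p(4)[rule_format, of 0 "s * P"] p(4)[rule_format, of "s * P" "d a b"] p(1,2)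
      by (auto simp: w_def between_def)
    have m2: "m \<le> 2 ^ r" using m less_exp[of r] by linarith
    have "\<exists>l<m. \<exists>v\<in>between (x l) (x (Suc l)). d (w s) v \<le> r * \<delta>" if "s \<le> r" for s
      using geodesic_polygon[OF slim, of m x r "w s"] xG \<open>m \<noteq> 0\<close> m2 wI[OF that] x(1,2) by simp
    then obtain f v where f: "\<And>s. s \<le> r \<Longrightarrow> f s < m"
      "\<And>s. s \<le> r \<Longrightarrow> v s \<in> between (x (f s)) (x (Suc (f s)))" "\<And>s. s \<le> r \<Longrightarrow> d (w s) (v s) \<le> r * \<delta>"
      by metis
    obtain s t where st: "s < t" "t \<le> r" "f s = f t" using pigeonhole_label[OF f(1) m] .
    define l where "l = f s"
    have l: "l < m" "x l \<in> carrier G" "x (Suc l) \<in> carrier G"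
      using f(1)[of s] st xG by (auto simp: l_def)
    have v: "v s \<in> between (x l) (x (Suc l))" "v t \<in> between (x l) (x (Suc l))"
      using f(2)[of s] f(2)[of t] st by (auto simp: l_def)
    have vG: "v s \<in> carrier G" "v t \<in> carrier G" using v between_subset by blast+
    have wG': "w s \<in> carrier G" "w t \<in> carrier G" using wG st by auto
    have "(s + 1) * P \<le> t * P" using st by (intro mult_le_mono1) simp
    then have "P \<le> t * P - s * P" by (simp add: algebra_simps)
    also have "\<dots> = d (w s) (w t)"
      using p(4)[rule_format, of "s * P" "t * P"] sP[OF st(2)] st by (simp add: w_def)
    finally have P: "P \<le> d (w s) (w t)" .
    have wv: "d (w s) (v s) \<le> r * \<delta>" "d (w t) (v t) \<le> r * \<delta>" using f(3) st by auto
    have short: False if "d (x l) (x (Suc l)) \<le> M"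
    proof -
      have "d (v s) (x l) \<le> M" "d (x l) (v t) \<le> M"
        using v that dist_sym[OF vG(1) l(2)] by (auto simp: between_def)
      then have "d (w s) (w t) \<le> 2 * (r * \<delta> + M)"
        using dist_triangle3[OF wG'(1) vG wG'(2)] dist_triangle[OF vG(1) l(2) vG(2)] wv
          dist_sym[OF vG(2) wG'(2)] by simp
      then show False using P by (simp add: P_def)
    qed
    consider "inv (x l) \<otimes> x (Suc l) \<in> Y \<or> inv (x (Suc l)) \<otimes> x l \<in> Y"
      | j where "j \<in> {1..n}" "inv (x l) \<otimes> x (Suc l) \<in> K j" "\<not> (j = i \<and> x l \<in> K i)"
      using edge[OF _ l(1)] by blast
    then show False
    proof cases
      case 1
      then have "d (x l) (x (Suc l)) \<le> M"
        using Y(2) dist_one_inv_mult[OF l(2,3)] dist_one_inv_mult[OF l(3,2)] dist_sym[OF l(2,3)] by metis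
      then show False by (rule short)
    next
      case 2
      have "x l \<in> x l <# K j" "x (Suc l) \<in> x l <# K j"
        using l 2 KG[OF 2(1)] K[OF 2(1)] by (simp_all add: mem_l_coset subgroup.one_closed)
      then have "\<exists>c\<in>x l <# K j. d u c \<le> \<tau>" if "u \<in> between (x l) (x (Suc l))" for u
        using quasiconvex_l_coset[OF qc[OF 2(1)] l(2)] that unfolding quasiconvex_def by blast
      then have "\<exists>k\<in>K j. d u (x l \<otimes> k) \<le> \<tau>" if "u \<in> between (x l) (x (Suc l))" for u
        using that unfolding bex_l_coset by blast
      then obtain k k' where k: "k \<in> K j" "d (v s) (x l \<otimes> k) \<le> \<tau>" and k': "k' \<in> K j" "d (v t) (x l \<otimes> k') \<le> \<tau>"
        using v by blast
      obtain c where c: "c \<in> K i" "d (w s) c \<le> \<tau>"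
        using qc[OF i] wI[of s] ab st unfolding quasiconvex_def by (meson less_imp_le_nat le_trans)
      obtain c' where c': "c' \<in> K i" "d (w t) c' \<le> \<tau>"
        using qc[OF i] wI[of t] ab st unfolding quasiconvex_def by blast
      have cG: "c \<in> carrier G" "c' \<in> carrier G" using c c' KG[OF i] by auto
      have kG: "x l \<otimes> k \<in> carrier G" "x l \<otimes> k' \<in> carrier G" using k k' l KG[OF 2(1)] by auto
      have "d c (x l \<otimes> k) \<le> 2 * \<tau> + r * \<delta>"
        using dist_triangle3[OF cG(1) wG'(1) vG(1) kG(1)] dist_sym[OF cG(1) wG'(1)] c k wv by linarith
      moreover have "d c' (x l \<otimes> k') \<le> 2 * \<tau> + r * \<delta>"
        using dist_triangle3[OF cG(2) wG'(2) vG(2) kG(2)] dist_sym[OF cG(2) wG'(2)] c' k' wv by linarith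
      moreover have "R \<le> d c c'"
        using dist_triangle3[OF wG'(1) cG wG'(2)] dist_sym[OF cG(2) wG'(2)] c c' P unfolding P_def by linarith
      \<comment> \<open>This is exactly the configuration excluded from the relative metric of
        \<open>K i\<close>.\<close>
      ultimately have "i = j \<and> x l \<in> K i"
        using separated_atD[OF R l(2) i 2(1) c(1) c'(1) k(1) k'(1)] by blast
      then show False using 2(3) by blast
    qed
  qed
  then show ?thesis by blast
qed

text \<open>Coning off does not increase distances, so thinness of triangles passes from
  \<open>G\<close> to the sets \<open>L\<close> of points of \<open>H\<close> near geodesics. The
  critical condition concerns pairs joined by an edge: a peripheral edge from \<open>x\<close> may
  be long in \<open>G\<close>, but its geodesics run near the coset \<open>x <# K j\<close>, which
  has diameter at most 1 after coning.\<close>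

lemma hyperbolic_coned_off_subgroup:
  assumes slim: "slim \<delta>" and H: "subgroup H G" "quasiconvex \<sigma> H"
    and K: "\<And>j. j \<in> J \<Longrightarrow> subgroup (K j) G" "\<And>j. j \<in> J \<Longrightarrow> K j \<subseteq> H"
    and qc: "\<And>j. j \<in> J \<Longrightarrow> quasiconvex \<tau> (K j)"
  defines "Y \<equiv> {h \<in> H. d \<one> h \<le> 2 * \<sigma> + 1}"
  shows "generate G (Y \<union> (\<Union>j\<in>J. K j)) = H"
    and "hyperbolic_graph (cayley (G\<lparr>carrier := H\<rparr>) (Y \<union> (\<Union>j\<in>J. K j)))"
proof -
  have HG: "H \<subseteq> carrier G" using H(1) by (rule subgroup.subset)
  define Z where "Z = Y \<union> (\<Union>j\<in>J. K j)"
  have YH: "Y \<subseteq> H" and ZH: "Z \<subseteq> H" using K(2) by (auto simp: Y_def Z_def)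
  have Ygen: "generate G Y = H" unfolding Y_def using quasiconvex_finite_generation(1)[OF H] .
  have Zgen: "generate G Z = H"
  proof
    show "generate G Z \<subseteq> H" using generate_subgroup_incl[OF ZH H(1)] .
    show "H \<subseteq> generate G Z" unfolding Ygen[symmetric] by (rule mono_generate) (auto simp: Z_def)
  qed
  then show "generate G (Y \<union> (\<Union>j\<in>J. K j)) = H" by (simp add: Z_def)
  interpret C: connected_graph H "cayley (G\<lparr>carrier := H\<rparr>) Z"
    using connected_graph_cayley_subgroup[OF H(1) ZH Zgen] .
  let ?dC = "graph_dist (cayley (G\<lparr>carrier := H\<rparr>) Z)"
  \<comment> \<open>The letters of \<open>Y\<close> alone already join \<open>a\<close> and
    \<open>b\<close> within \<open>d a b\<close> steps.\<close>
  have dC_le: "?dC a b \<le> d a b" if ab: "a \<in> H" "b \<in> H" for a b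
  proof -
    have und: "graph_dist (cayley G Y) \<one> h \<le> 1 * d \<one> h + 0" if "h \<in> H" for h
      unfolding Y_def using quasiconvex_finite_generation(2)[OF H that] by simp
    note bound = undistorted_dist_bound[OF H(1) YH Ygen und ab]
    have "cayley G Y \<subseteq> cayley G Z" by (auto simp: cayley_def Z_def)
    then have "(a, b) \<in> cayley G Z ^^ graph_dist (cayley G Y) a b"
      using bound(1) unfolding relpow_fun_conv by blast
    then have "?dC a b \<le> graph_dist (cayley G Y) a b"
      using relpow_cayley_subgroup[OF H(1) ZH ab(1)] by (intro graph_dist_le) blast
    then show ?thesis using bound(2) by simp
  qed
  define L where "L x y = {u \<in> H. \<exists>v\<in>between x y. d u v \<le> \<sigma>}" for x y
  \<comment> \<open>\<open>D\<close> dominates \<open>2 * \<sigma> + \<delta>\<close> from thin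
    triangles, \<open>3 * \<sigma> + 1\<close> from edges labelled in \<open>Y\<close>,
    \<open>\<sigma> + \<tau> + 1\<close> from peripheral edges and \<open>2 * \<sigma> + 1\<close>
    from chains.\<close>
  define D where "D = 3 * \<sigma> + \<tau> + \<delta> + 2"
  have "\<exists>\<epsilon>. C.slim \<epsilon>"
  proof (rule C.guessing_geodesics[of L D])
    show "L x y \<subseteq> H" for x y by (auto simp: L_def)
  next
    fix x y z u assume xyz: "x \<in> H" "y \<in> H" "z \<in> H" and u: "u \<in> L x y"
    have xyzG: "x \<in> carrier G" "y \<in> carrier G" "z \<in> carrier G" using xyz HG by auto
    obtain v where v: "u \<in> H" "v \<in> between x y" "d u v \<le> \<sigma>" using u by (auto simp: L_def)
    obtain w where w: "w \<in> between x z \<union> between z y" "d v w \<le> \<delta>" using slimD[OF slim xyzG v(2)] by blast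
    obtain u' where u': "u' \<in> H" "d w u' \<le> \<sigma>" using H(2) w(1) xyz unfolding quasiconvex_def by blast
    have V: "u \<in> carrier G" "v \<in> carrier G" "w \<in> carrier G" "u' \<in> carrier G"
      using v(1) u' HG between_subset[OF v(2)] w(1) between_subset by blast+
    have "d u u' \<le> D" using dist_triangle3[OF V] v w u' by (simp add: D_def)
    then have "?dC u u' \<le> D" using dC_le[OF v(1) u'(1)] by linarith
    moreover have "u' \<in> L x z \<union> L z y" using w u' dist_sym[OF V(3,4)] by (auto simp: L_def)
    ultimately show "\<exists>w'\<in>L x z \<union> L z y. ?dC u w' \<le> D" by blast
  next
    fix x y u assume xy: "x \<in> H" "y \<in> H" and le: "?dC x y \<le> 1" and u: "u \<in> L x y"
    have xyG: "x \<in> carrier G" "y \<in> carrier G" using xy HG by auto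
    obtain v where v: "u \<in> H" "v \<in> between x y" "d u v \<le> \<sigma>" using u by (auto simp: L_def)
    have V: "u \<in> carrier G" "v \<in> carrier G" using v(1) HG between_subset[OF v(2)] by auto
    have short: "?dC u x \<le> D" if "d x y \<le> 2 * \<sigma> + 1"
    proof -
      have "d v x \<le> 2 * \<sigma> + 1" using v(2) that dist_sym[OF V(2) xyG(1)] by (simp add: between_def)
      then have "d u x \<le> D" using dist_triangle[OF V xyG(1)] v(3) by (simp add: D_def)
      then show ?thesis using dC_le[OF v(1) xy(1)] by linarith
    qed
    consider "x = y" | "(x, y) \<in> cayley (G\<lparr>carrier := H\<rparr>) Z"
      using C.relpow_graph_dist[OF xy] le by (cases "?dC x y") auto
    then show "?dC u x \<le> D"
    proof cases
      case 1
      then show ?thesis using short xyG by simp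
    next
      case 2
      then have "inv x \<otimes> y \<in> Z \<or> inv y \<otimes> x \<in> Z" unfolding cayley_subgroup[OF H(1)] by (auto simp: cayley_def)
      then consider "inv x \<otimes> y \<in> Y \<or> inv y \<otimes> x \<in> Y" | j where "j \<in> J" "inv x \<otimes> y \<in> K j \<or> inv y \<otimes> x \<in> K j"
        unfolding Z_def by blast
      then show ?thesis
      proof cases
        case 1
        then show ?thesis
          using short dist_one_inv_mult[OF xyG] dist_one_inv_mult[OF xyG(2,1)] dist_sym[OF xyG]
          by (auto simp: Y_def)
      next
        case 2
        have "inv (inv y \<otimes> x) = inv x \<otimes> y" using xyG by (simp add: inv_mult_group)
        then have j: "inv x \<otimes> y \<in> K j" using 2 K(1)[OF 2(1)] by (metis subgroup.m_inv_closed)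
        have KG: "K j \<subseteq> carrier G" using K(2)[OF 2(1)] HG by blast
        have "x \<in> x <# K j" "y \<in> x <# K j"
          using xyG j KG K(1)[OF 2(1)] by (simp_all add: mem_l_coset subgroup.one_closed)
        then have "\<exists>c\<in>x <# K j. d v c \<le> \<tau>"
          using quasiconvex_l_coset[OF qc[OF 2(1)] xyG(1)] v(2) unfolding quasiconvex_def by blast
        then obtain k where k: "k \<in> K j" "d v (x \<otimes> k) \<le> \<tau>" unfolding bex_l_coset by blast
        have kG: "k \<in> carrier G" "x \<otimes> k \<in> H" using k K(2)[OF 2(1)] KG xy H(1) by (auto simp: subgroup.m_closed)
        have "?dC u (x \<otimes> k) \<le> \<sigma> + \<tau>"
          using dC_le[OF v(1) kG(2)] dist_triangle[OF V, of "x \<otimes> k"] xyG kG k v(3) by simp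
        moreover have "inv x \<otimes> (x \<otimes> k) \<in> Z" using 2(1) k kG xyG by (auto simp: Z_def inv_mult_cancel)
        then have "(x \<otimes> k, x) \<in> cayley G Z" using xyG kG by (simp add: cayley_def)
        then have "(x \<otimes> k, x) \<in> cayley (G\<lparr>carrier := H\<rparr>) Z ^^ 1"
          using kG xy unfolding cayley_subgroup[OF H(1)] by simp
        then have "?dC (x \<otimes> k) x \<le> 1" by (rule graph_dist_le)
        ultimately show ?thesis
          using C.dist_triangle[OF v(1) kG(2) xy(1)] by (simp add: D_def)
      qed
    qed
  next
    fix x y assume xy: "x \<in> H" "y \<in> H"
    obtain p s where p: "\<And>i. i \<le> d x y \<Longrightarrow> p i \<in> between x y" "\<And>i. i \<le> d x y \<Longrightarrow> s i \<in> H"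
      "\<And>i. i \<le> d x y \<Longrightarrow> d (p i) (s i) \<le> \<sigma>" "s 0 = x" "s (d x y) = y"
      "\<And>i. i < d x y \<Longrightarrow> d (s i) (s (Suc i)) \<le> 2 * \<sigma> + 1"
      using quasiconvex_chain[OF H(2) xy] by metis
    have "s i \<in> L x y" if i: "i \<le> d x y" for i
    proof -
      have "p i \<in> carrier G" "s i \<in> carrier G" using between_subset[OF p(1)[OF i]] p(2)[OF i] HG by auto
      then have "d (s i) (p i) \<le> \<sigma>" using p(3)[OF i] dist_sym by simp
      then show ?thesis using p(1,2)[OF i] by (auto simp: L_def)
    qed
    moreover have "?dC (s i) (s (Suc i)) \<le> D" if i: "i < d x y" for i
      using dC_le[of "s i" "s (Suc i)"] p(2)[of i] p(2)[of "Suc i"] p(6)[OF i] i by (simp add: D_def)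
    ultimately show "\<exists>z N. z 0 = x \<and> z N = y \<and> (\<forall>i\<le>N. z i \<in> L x y) \<and> (\<forall>i<N. ?dC (z i) (z (Suc i)) \<le> D)"
      using p(4,5) by blast
  qed
  then show "hyperbolic_graph (cayley (G\<lparr>carrier := H\<rparr>) (Y \<union> (\<Union>j\<in>J. K j)))"
    using C.hyperbolic_graph_iff_slim by (simp add: Z_def)
qed

text \<open>The short elements of \<open>H\<close> form the finite relative generating set. By
  \<open>rel_path_bounded\<close> relative balls of \<open>K i\<close> lie in balls of
  \<open>G\<close>, which meet \<open>K i\<close> in finite sets because \<open>H\<close> is locally
  finite.\<close>

lemma rel_hyperbolic_subgroup:
  assumes slim: "slim \<delta>" and H: "subgroup H G" "locally_finite H" "quasiconvex \<sigma> H"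
    and K: "\<And>j. j \<in> {1..n} \<Longrightarrow> subgroup (K j) G" "\<And>j. j \<in> {1..n} \<Longrightarrow> K j \<subseteq> H"
    and qc: "\<And>j. j \<in> {1..n} \<Longrightarrow> quasiconvex \<tau> (K j)"
    and sep: "separated n K"
  shows "rel_hyperbolic (G\<lparr>carrier := H\<rparr>) n K"
proof -
  have HG: "H \<subseteq> carrier G" using H(1) by (rule subgroup.subset)
  define Y where "Y = {h \<in> H. d \<one> h \<le> 2 * \<sigma> + 1}"
  let ?Z = "Y \<union> (\<Union>j\<in>{1..n}. K j)"
  note cone = hyperbolic_coned_off_subgroup[OF slim H(1,3) K qc, of "{1..n}" "\<lambda>j. j", folded Y_def]
  have "finite Y" using H(2) unfolding Y_def locally_finite_def by blast
  moreover have "Y \<subseteq> H" by (auto simp: Y_def)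
  moreover have "generate (G\<lparr>carrier := H\<rparr>) ?Z = H"
  proof -
    have "?Z \<subseteq> H" using \<open>Y \<subseteq> H\<close> K(2) by blast
    from generate_consistent[OF this H(1)] show ?thesis using cone(1) by metis
  qed
  moreover have "finite {b \<in> K i. rel_dist (G\<lparr>carrier := H\<rparr>) Y n K i a b \<le> enat r}"
    if i: "i \<in> {1..n}" and a: "a \<in> K i" for i a r
  proof -
    obtain B where B: "\<forall>a\<in>K i. \<forall>b\<in>K i. \<forall>m\<le>r.
        (a, b) \<in> rel_edges (G\<lparr>carrier := H\<rparr>) Y n K i ^^ m \<longrightarrow> d a b \<le> B"
      using rel_path_bounded[OF slim H(1) K(1) qc sep, of Y "2 * \<sigma> + 1" i r] i HG
      by (auto simp: Y_def)
    have "{b \<in> K i. rel_dist (G\<lparr>carrier := H\<rparr>) Y n K i a b \<le> enat r} \<subseteq> {b \<in> K i. d a b \<le> B}"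
      using B a unfolding rel_dist_le_iff by blast
    moreover have "finite {b \<in> K i. d a b \<le> B}"
      using locally_finite_ball[OF K(1)[OF i] locally_finite_subset[OF H(2) K(2)[OF i]] a] .
    ultimately show ?thesis by (rule finite_subset)
  qed
  moreover have "subgroup (K i) (G\<lparr>carrier := H\<rparr>)" if "i \<in> {1..n}" for i
    using subgroup_incl[OF K(1)[OF that] H(1) K(2)[OF that]] .
  ultimately show ?thesis
    unfolding rel_hyperbolic_def using cone(2) by (intro conjI exI[of _ Y]) auto
qed

end

theorem proposition5p1:
  fixes G :: "('a, 'b) monoid_scheme" and X H1 H2 :: "'a set"
  assumes "group G"
    and "X \<subseteq> carrier G" and "generate G X = carrier G"
    and "hyperbolic_graph (cayley G X)"
    and "subgroup H1 G" and "subgroup H2 G"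
    and "hyp_embedded G X 1 (\<lambda>_. H1)"
    and "hyp_embedded G X 1 (\<lambda>_. H2)"
  shows "finite (intersection_classes G H1 H2) \<and>
    (\<forall>n K. class_representatives G H1 H2 n K \<longrightarrow>
       rel_hyperbolic (G\<lparr>carrier := H1\<rparr>) n K \<and>
       hyp_embedded G X n K)"
proof -
  interpret group G by fact
  interpret cayley_graph G X by unfold_locales fact+
  obtain \<delta> where \<delta>: "slim \<delta>" using assms(4) hyperbolic_graph_iff_slim by blast
  have emb1: "locally_finite H1" "\<exists>\<sigma>. quasiconvex \<sigma> H1" "separated 1 (\<lambda>_. H1)"
    and emb2: "\<exists>\<sigma>. quasiconvex \<sigma> H2" "separated 1 (\<lambda>_. H2)"
    using assms(7,8) unfolding hyp_embedded_iff[OF \<delta>] by auto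
  obtain \<sigma>1 \<sigma>2 where "quasiconvex \<sigma>1 H1" "quasiconvex \<sigma>2 H2" using emb1 emb2 by blast
  \<comment> \<open>Both subgroups get a common constant, as the locale works with a single
    \<sigma>.\<close>
  then have qc: "quasiconvex (max \<sigma>1 \<sigma>2) H1" "quasiconvex (max \<sigma>1 \<sigma>2) H2"
    by (auto elim: quasiconvex_mono)
  interpret separated_subgroups G X H1 H2 \<delta> "max \<sigma>1 \<sigma>2"
    by (intro separated_subgroups.intro separated_subgroups_axioms.intro cayley_graph_axioms)
      (fact \<delta> assms(5,6) emb1 emb2 qc)+
  have "rel_hyperbolic (G\<lparr>carrier := H1\<rparr>) n K \<and> hyp_embedded G X n K"
    if reps: "class_representatives G H1 H2 n K" for n K
  proof -
    have sep: "separated n K" using separated_class_representatives[OF reps] .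
    have K_form: "\<exists>g\<in>carrier G. K i = H1 \<inter> conj_set G g H2" if "i \<in> {1..n}" for i
      using reps that unfolding class_representatives_def conj_intersections_def image_iff by blast
    have K: "subgroup (K i) G" "K i \<subseteq> H1" "\<exists>\<tau>. quasiconvex \<tau> (K i)" if i: "i \<in> {1..n}" for i
      using K_form[OF i] subgroups_Inter_pair[OF assms(5) subgroup_conj_set[OF assms(6)]]
        quasiconvex_intersection by auto
    obtain \<tau> where \<tau>: "\<And>i. i \<in> {1..n} \<Longrightarrow> quasiconvex (\<tau> i) (K i)" using K(3) by metis
    have qcK: "quasiconvex (Max (\<tau> ` {1..n})) (K i)" if "i \<in> {1..n}" for i
      using \<tau>[OF that] by (rule quasiconvex_mono) (use that in auto)
    \<comment> \<open>Local finiteness is inherited from \<open>H1\<close>; with quasiconvexity and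
      separation of the representatives, the reformulation applies backwards.\<close>
    have "hyp_embedded G X n K"
      unfolding hyp_embedded_iff[OF \<delta>] using K sep locally_finite_subset[OF emb1(1)] by blast
    moreover have "rel_hyperbolic (G\<lparr>carrier := H1\<rparr>) n K"
      using rel_hyperbolic_subgroup[OF \<delta> assms(5) emb1(1) qc(1) K(1,2) qcK sep] .
    ultimately show ?thesis by blast
  qed
  then show ?thesis using finite_intersection_classes by blast
qed

end
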